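(* Let $\mu>0$ and let $\eta:\mathbb{R}^m\to\mathbb{R}^m$ be the element-wise symmetric clipping operator, $\eta(\boldsymbol{u})_j=-\mu$ if $u_j\le-\mu$, $\eta(\boldsymbol{u})_j=u_j$ if $|u_j|<\mu$, $\eta(\boldsymbol{u})_j=\mu$ if $u_j\ge\mu$. Let $\mathcal{X}\subseteq\mathbb{R}^n$ be a cone and let $S_\mathcal{X}=\{\boldsymbol{x}/\|\boldsymbol{x}\|_2:\boldsymbol{x}\in\mathcal{X}\setminus\{0\}\}$. Assume $S_\mathcal{X}$ has finite upper box-counting dimension $\dim(S_\mathcal{X})<k$ and that there is $\epsilon^*\in(0,1/2)$ with $N_{S_\mathcal{X}}(\epsilon)\le\epsilon^{-k}$ for all $\epsilon<\epsilon^*$. Let $\boldsymbol{A}\in\mathbb{R}^{m\times n}$ have i.i.d. entries $A_{ij}\sim\mathcal{N}(0,1)$, and for $R>0$ let $\mathcal{X}_R=\{\boldsymbol{x}\in\mathcal{X}:\|\boldsymbol{x}\|_2<R\}$. There exists an absolute constant $C>0$ such that, if $m\ge k\log(1/\epsilon^* )$ and $R<\mu\left(\tfrac12-\tfrac{k+1}{m}\right)$, then $$\mathbb{P}\big(\eta(\boldsymbol{A}\boldsymbol{x})=\eta(\boldsymbol{A}\boldsymbol{u})\text{ for some }\boldsymbol{x}\neq\boldsymbol{u}\in\mathcal{X}_R\big)\le 12e^{-Cm}.$$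
   Context: A set $\mathcal{X}$ is a cone if $g\mathcal{X}=\mathcal{X}$ for all $g>0$. For a compact set $\mathcal{S}$, the covering number $N_\mathcal{S}(\epsilon)$ is the minimum number of closed Euclidean balls of radius $\epsilon$ with centres in $\mathcal{S}$ needed to cover $\mathcal{S}$, and the upper box-counting dimension is $\dim(\mathcal{S})=\limsup_{\epsilon\to0}\log N_\mathcal{S}(\epsilon)/(-\log\epsilon)$. *)

theory Defs
  imports "HOL-Probability.Probability"
begin

text \<open>Vectors of R^n are represented as functions nat => real vanishing outside {..<n};
  this allows the absolute constant C to be quantified before the dimensions m, n.\<close>

definition vecs :: "nat \<Rightarrow> (nat \<Rightarrow> real) set" where
  "vecs n = {x. \<forall>j\<ge>n. x j = 0}"

definition enorm :: "nat \<Rightarrow> (nat \<Rightarrow> real) \<Rightarrow> real" where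
  "enorm n x = sqrt (\<Sum>j<n. (x j)^2)"

definition is_cone :: "(nat \<Rightarrow> real) set \<Rightarrow> bool" where
  "is_cone X \<longleftrightarrow> (\<forall>g::real. g > 0 \<longrightarrow> (\<lambda>x. \<lambda>j. g * x j) ` X = X)"

definition sphere_proj :: "nat \<Rightarrow> (nat \<Rightarrow> real) set \<Rightarrow> (nat \<Rightarrow> real) set" where
  "sphere_proj n X = {(\<lambda>j. x j / enorm n x) | x. x \<in> X \<and> x \<noteq> (\<lambda>_. 0)}"

definition covering_number :: "nat \<Rightarrow> (nat \<Rightarrow> real) set \<Rightarrow> real \<Rightarrow> nat" where
  "covering_number n S eps = (LEAST N. \<exists>F. finite F \<and> F \<subseteq> S \<and> card F = N \<and>
      S \<subseteq> (\<Union>c\<in>F. {y. enorm n (\<lambda>j. y j - c j) \<le> eps}))"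

definition upper_box_dim :: "nat \<Rightarrow> (nat \<Rightarrow> real) set \<Rightarrow> ereal" where
  "upper_box_dim n S = Limsup (at_right 0)
      (\<lambda>eps. ereal (ln (real (covering_number n S eps)) / (- ln eps)))"

definition clip :: "real \<Rightarrow> real \<Rightarrow> real" where
  "clip \<mu> t = (if t \<le> -\<mu> then -\<mu> else if t \<ge> \<mu> then \<mu> else t)"

definition clip_vec :: "nat \<Rightarrow> real \<Rightarrow> (nat \<Rightarrow> real) \<Rightarrow> (nat \<Rightarrow> real)" where
  "clip_vec m \<mu> u = (\<lambda>i. if i < m then clip \<mu> (u i) else 0)"

definition mat_vec :: "nat \<Rightarrow> nat \<Rightarrow> (nat \<times> nat \<Rightarrow> real) \<Rightarrow> (nat \<Rightarrow> real) \<Rightarrow> (nat \<Rightarrow> real)" where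
  "mat_vec m n A x = (\<lambda>i. if i < m then (\<Sum>j<n. A (i, j) * x j) else 0)"

definition gaussian_matrix :: "nat \<Rightarrow> nat \<Rightarrow> (nat \<times> nat \<Rightarrow> real) measure" where
  "gaussian_matrix m n = (\<Pi>\<^sub>M ij\<in>{..<m} \<times> {..<n}. density lborel std_normal_density)"

end

theory Submission
  imports Defs
begin

text \<open>
  Normalise to the unit vectors \<open>S\<close> of the cone, put \<open>t = \<mu> / R\<close> and let \<open>j\<close> be \<open>m - 2 * k - 2\<close> rounded
  up, so that \<open>t \<ge> 2 * m / j\<close>. With probability at least \<open>1 - 3 * exp (- C * m)\<close> no \<open>x\<close> in \<open>S\<close> has \<open>j\<close>
  rows with \<open>\<bar>(A x)\<^sub>i\<bar> \<ge> t\<close>: for a point of a net this is a Gaussian tail bound that beats the entropy of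
  the net, and chaining carries it over to \<open>S\<close>. Hence every admissible \<open>x\<close> leaves a set \<open>I\<close> of at
  least \<open>2 * k + 2\<close> rows unclipped, on which equal clipped images force \<open>A\<^sub>I x = A\<^sub>I u\<close>. Since \<open>S\<close> has box
  dimension at most \<open>k\<close>, for each such \<open>I\<close> a covering and small ball argument shows that \<open>A\<^sub>I\<close> is almost
  surely injective on the cone.
\<close>

section \<open>Rows of a Gaussian matrix\<close>

text \<open>Entropy is scarce: at scale \<open>eps_star\<close> a net may have \<open>exp m\<close>
  points, and nothing relates \<open>n\<close> to \<open>m\<close>, so no operator norm bound over
  all of R^n can help; oscillation is controlled only along links between nets of \<open>S\<close>.
  The count bound holds for every admissible \<open>j\<close> because the threshold rises as the
  count falls: \<open>t \<ge> 2 * m / j\<close> gives a tail exponent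
  \<open>t\<^sup>2 * j / 2\<close> of at least \<open>2 * m\<^sup>2 / j\<close>, while the entropy
  below scale \<open>eps_star\<close> is governed by \<open>2 * k \<le> m - j\<close>. The set
  \<open>I\<close> of unclipped rows depends on both the matrix and the vector. This causes no loss:
  for each fixed \<open>I\<close> failure of injectivity has probability zero, so all subsets of
  rows can be united at no cost and the whole exponential bound comes from the count. Both failure
  events are uncountable unions over vectors, so each is enclosed in a measurable set instead of
  being measured itself.\<close>

lemma prob_space_gaussian_matrix: "prob_space (gaussian_matrix m n)"
  unfolding gaussian_matrix_def by (intro prob_space_PiM prob_space_normal_density) simp

text \<open>The joint law of the coordinates is the product measure itself and its marginals are the
  factors, which is the product characterisation of independence. That characterisation asks for a
  nonempty index set, hence the separate case.\<close>

lemma indep_vars_PiM_coordinates: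
  assumes "finite I" "\<And>i. i \<in> I \<Longrightarrow> prob_space (N i)"
  shows "prob_space.indep_vars (Pi\<^sub>M I N) N (\<lambda>i \<omega>. \<omega> i) I"
proof -
  interpret prob_space "Pi\<^sub>M I N" by (intro prob_space_PiM assms)
  have 1: "distr (Pi\<^sub>M I N) (Pi\<^sub>M I N) (\<lambda>x. \<lambda>i\<in>I. x i) = Pi\<^sub>M I N"
    by (subst distr_cong[where g = "\<lambda>x. x" and L = "Pi\<^sub>M I N"])
       (auto simp: space_PiM restrict_def PiE_def extensional_def fun_eq_iff)
  have 2: "Pi\<^sub>M I (\<lambda>i. distr (Pi\<^sub>M I N) (N i) (\<lambda>\<omega>. \<omega> i)) = Pi\<^sub>M I N"
    by (intro PiM_cong refl distr_PiM_component assms)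
  have 3: "(\<lambda>\<omega>. \<omega> i) \<in> Pi\<^sub>M I N \<rightarrow>\<^sub>M N i" if "i \<in> I" for i
    using that by (rule measurable_component_singleton)
  show ?thesis
  proof (cases "I = {}")
    case False
    with 1 2 3 show ?thesis
      by (subst indep_vars_iff_distr_eq_PiM') auto
  next
    case True
    show ?thesis unfolding indep_vars_def indep_sets_def using True by auto
  qed
qed

lemma gaussian_row_distributed:
  assumes "i < m" "enorm n v = 1"
  shows "distributed (gaussian_matrix m n) lborel (\<lambda>A. mat_vec m n A v i) std_normal_density"
proof -
  let ?D = "density lborel std_normal_density"
  interpret prob_space "gaussian_matrix m n" by (rule prob_space_gaussian_matrix)
  \<comment> \<open>Coordinates with \<open>v j = 0\<close> are dropped because the sum rule for
    independent normals wants every standard deviation \<open>\<bar>v j\<bar>\<close> to be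
    positive.\<close>
  define J where "J = {j. j < n \<and> v j \<noteq> 0}"
  have fin: "finite J" unfolding J_def by simp
  have sum1: "(\<Sum>j\<in>J. (v j)\<^sup>2) = 1"
  proof -
    have "(\<Sum>j\<in>J. (v j)\<^sup>2) = (\<Sum>j<n. (v j)\<^sup>2)"
      unfolding J_def by (intro sum.mono_neutral_left) auto
    then show ?thesis using assms(2) unfolding enorm_def by simp
  qed
  have ne: "J \<noteq> {}" using sum1 by auto
  have "indep_vars (\<lambda>_. ?D) (\<lambda>ij \<omega>. \<omega> ij) ({..<m} \<times> {..<n})"
    unfolding gaussian_matrix_def
    by (rule indep_vars_PiM_coordinates) (auto intro: prob_space_normal_density)
  then have 1: "indep_vars (\<lambda>j. Pi\<^sub>M {(i, j)} (\<lambda>_. ?D)) (\<lambda>j \<omega>. restrict (\<lambda>ij. \<omega> ij) {(i, j)}) J"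
    by (rule indep_vars_restrict) (use assms in \<open>auto simp: J_def disjoint_family_on_def\<close>)
  have "indep_vars (\<lambda>_. borel) (\<lambda>j \<omega>. v j * (restrict (\<lambda>ij. \<omega> ij) {(i, j)}) (i, j)) J"
  proof (rule indep_vars_compose2[OF 1, where Y = "\<lambda>j \<omega>. v j * \<omega> (i, j)"])
    fix j :: nat
    have "(\<lambda>\<omega>. \<omega> (i, j)) \<in> borel_measurable (Pi\<^sub>M {(i, j)} (\<lambda>_. ?D))"
      using measurable_component_singleton[of "(i, j)" "{(i, j)}" "\<lambda>_. ?D"]
      by (simp cong: measurable_cong_sets)
    then show "(\<lambda>\<omega>. v j * \<omega> (i, j)) \<in> borel_measurable (Pi\<^sub>M {(i, j)} (\<lambda>_. ?D))"
      by simp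
  qed
  then have ind: "indep_vars (\<lambda>_. borel) (\<lambda>j \<omega>. v j * \<omega> (i, j)) J" by simp
  have comp: "distributed (gaussian_matrix m n) lborel (\<lambda>\<omega>. \<omega> (i, j)) std_normal_density"
    if "j \<in> J" for j
  proof -
    have ij: "(i, j) \<in> {..<m} \<times> {..<n}" using that assms by (simp add: J_def)
    have "distr (gaussian_matrix m n) ?D (\<lambda>\<omega>. \<omega> (i, j)) = ?D"
      unfolding gaussian_matrix_def using ij
      by (intro distr_PiM_component[where M = "\<lambda>_. ?D"]) (auto intro: prob_space_normal_density)
    moreover have "(\<lambda>\<omega>. \<omega> (i, j)) \<in> gaussian_matrix m n \<rightarrow>\<^sub>M ?D"
      unfolding gaussian_matrix_def using ij by (rule measurable_component_singleton)
    ultimately show ?thesis unfolding distributed_def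
      by (simp cong: distr_cong measurable_cong_sets)
  qed
  have "distributed (gaussian_matrix m n) lborel (\<lambda>\<omega>. \<Sum>j\<in>J. v j * \<omega> (i, j))
          (normal_density (\<Sum>j\<in>J. 0) (sqrt (\<Sum>j\<in>J. \<bar>v j\<bar>\<^sup>2)))"
  proof (rule sum_indep_normal[OF fin ne ind])
    fix j assume "j \<in> J"
    then show "0 < \<bar>v j\<bar>" by (simp add: J_def)
    show "distributed (gaussian_matrix m n) lborel (\<lambda>\<omega>. v j * \<omega> (i, j)) (normal_density 0 \<bar>v j\<bar>)"
      using normal_density_affine[OF comp[OF \<open>j \<in> J\<close>], of "v j" 0] \<open>j \<in> J\<close> by (simp add: J_def)
  qed
  moreover have "(\<Sum>j\<in>J. v j * \<omega> (i, j)) = mat_vec m n \<omega> v i" for \<omega>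
    unfolding mat_vec_def J_def using assms
    by (auto intro!: sum.mono_neutral_cong_left simp: mult.commute)
  ultimately show ?thesis using sum1 by simp
qed

lemma measurable_mat_vec [measurable]:
  "(\<lambda>A. mat_vec m n A v i) \<in> borel_measurable (gaussian_matrix m n)"
proof (cases "i < m")
  case True
  have "(\<lambda>\<omega>. \<omega> (i, j)) \<in> gaussian_matrix m n \<rightarrow>\<^sub>M density lborel std_normal_density" if "j < n" for j
    unfolding gaussian_matrix_def using that True by (intro measurable_component_singleton) auto
  then have "(\<lambda>\<omega>. \<omega> (i, j)) \<in> borel_measurable (gaussian_matrix m n)" if "j < n" for j
    using that by (simp cong: measurable_cong_sets)
  then show ?thesis unfolding mat_vec_def using True by simp
qed (simp add: mat_vec_def)

lemma indep_vars_gaussian_rows: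
  "prob_space.indep_vars (gaussian_matrix m n) (\<lambda>_. borel) (\<lambda>i A. mat_vec m n A v i) {..<m}"
proof -
  let ?D = "density lborel std_normal_density"
  interpret prob_space "gaussian_matrix m n" by (rule prob_space_gaussian_matrix)
  have 0: "indep_vars (\<lambda>_. ?D) (\<lambda>ij \<omega>. \<omega> ij) ({..<m} \<times> {..<n})"
    unfolding gaussian_matrix_def
    by (rule indep_vars_PiM_coordinates) (auto intro: prob_space_normal_density)
  have 1: "indep_vars (\<lambda>i. Pi\<^sub>M ({i} \<times> {..<n}) (\<lambda>_. ?D))
      (\<lambda>i \<omega>. restrict (\<lambda>ij. \<omega> ij) ({i} \<times> {..<n})) {..<m}"
    by (rule indep_vars_restrict[OF 0]) (auto simp: disjoint_family_on_def)
  have "indep_vars (\<lambda>_. borel)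
      (\<lambda>i \<omega>. \<Sum>j<n. (restrict (\<lambda>ij. \<omega> ij) ({i} \<times> {..<n})) (i, j) * v j) {..<m}"
  proof (rule indep_vars_compose2[OF 1, where Y = "\<lambda>i \<omega>. \<Sum>j<n. \<omega> (i, j) * v j"])
    fix i
    have "(\<lambda>\<omega>. \<omega> (i, j)) \<in> borel_measurable (Pi\<^sub>M ({i} \<times> {..<n}) (\<lambda>_. ?D))" if "j < n" for j
      using measurable_component_singleton[of "(i, j)" "{i} \<times> {..<n}" "\<lambda>_. ?D"] that
      by (simp cong: measurable_cong_sets)
    then show "(\<lambda>\<omega>. \<Sum>j<n. \<omega> (i, j) * v j) \<in> borel_measurable (Pi\<^sub>M ({i} \<times> {..<n}) (\<lambda>_. ?D))"
      by simp
  qed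
  then show ?thesis
    by (rule iffD1[OF indep_vars_cong, rotated -1]) (auto simp: mat_vec_def fun_eq_iff)
qed

text \<open>Reduces every estimate for a fixed vector to one-dimensional integrals. The functions
  may vary with the row, so that an event can constrain some rows only.\<close>

lemma nn_integral_prod_gaussian_rows:
  fixes f :: "nat \<Rightarrow> real \<Rightarrow> ennreal"
  assumes f [measurable]: "\<And>i. f i \<in> borel_measurable borel" and v: "enorm n v = 1"
  shows "(\<integral>\<^sup>+A. (\<Prod>i<m. f i (mat_vec m n A v i)) \<partial>gaussian_matrix m n) =
    (\<Prod>i<m. \<integral>\<^sup>+u. ennreal (std_normal_density u) * f i u \<partial>lborel)"
proof -
  interpret prob_space "gaussian_matrix m n" by (rule prob_space_gaussian_matrix)
  have "(\<integral>\<^sup>+A. (\<Prod>i<m. f i (mat_vec m n A v i)) \<partial>gaussian_matrix m n) =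
      (\<Prod>i<m. \<integral>\<^sup>+A. f i (mat_vec m n A v i) \<partial>gaussian_matrix m n)"
    by (intro indep_vars_nn_integral indep_vars_compose2[OF indep_vars_gaussian_rows]) auto
  also have "\<dots> = (\<Prod>i<m. \<integral>\<^sup>+u. ennreal (std_normal_density u) * f i u \<partial>lborel)"
    by (intro prod.cong refl distributed_nn_integral[symmetric] gaussian_row_distributed v) auto
  finally show ?thesis .
qed

section \<open>One-dimensional Gaussian integrals\<close>

lemma nn_integral_normal_density [simp]:
  "0 < \<sigma> \<Longrightarrow> (\<integral>\<^sup>+u. ennreal (normal_density \<mu> \<sigma> u) \<partial>lborel) = 1"
  by (subst nn_integral_eq_integral) auto

text \<open>The exponent \<open>3 / 8\<close> leaves \<open>1 / 2 - 3 / 8 = 1 / 8\<close>, so the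
  tilted density is exactly twice the normal density of standard deviation 2.\<close>

lemma std_normal_exp_square:
  "(\<integral>\<^sup>+u. ennreal (std_normal_density u) * ennreal (exp (3 / 8 * u\<^sup>2)) \<partial>lborel) = 2"
proof -
  have "std_normal_density u * exp (3 / 8 * u\<^sup>2) = 2 * normal_density 0 2 u" for u
    using real_sqrt_mult[of 4 2] by (simp add: normal_density_def real_sqrt_mult mult_exp_exp field_simps)
  then have "(\<integral>\<^sup>+u. ennreal (std_normal_density u) * ennreal (exp (3 / 8 * u\<^sup>2)) \<partial>lborel) =
      (\<integral>\<^sup>+u. ennreal 2 * ennreal (normal_density 0 2 u) \<partial>lborel)"
    by (intro nn_integral_cong) (simp only: ennreal_mult'[symmetric] normal_density_nonneg zero_le_numeral)
  also have "\<dots> = 2" by (subst nn_integral_cmult) auto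
  finally show ?thesis .
qed

lemma std_normal_density_le_half: "std_normal_density u \<le> 1 / 2"
proof -
  have "2 \<le> sqrt (2 * pi)" using pi_ge_two by (intro real_le_rsqrt) simp
  moreover have "exp (- u\<^sup>2 / 2) \<le> 1" by simp
  ultimately show ?thesis unfolding std_normal_density_def
    using mult_mono[of "1 / sqrt (2 * pi)" "1/2" "exp (- u\<^sup>2 / 2)" 1] by (simp add: field_simps)
qed

text \<open>The interval has length \<open>2 * r\<close> and the density is at most
  \<open>1 / 2\<close>, so no constant appears in front of \<open>r\<close>.\<close>

lemma std_normal_small_ball:
  assumes "0 \<le> r"
  shows "(\<integral>\<^sup>+u. ennreal (std_normal_density u) * indicator {u. \<bar>u\<bar> \<le> r} u \<partial>lborel) \<le> ennreal r"
proof -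
  have eq: "{u::real. \<bar>u\<bar> \<le> r} = {-r..r}" by auto
  have "(\<integral>\<^sup>+u. ennreal (std_normal_density u) * indicator {u. \<bar>u\<bar> \<le> r} u \<partial>lborel) \<le>
      (\<integral>\<^sup>+u. ennreal (1/2) * indicator {-r..r} u \<partial>lborel)"
    unfolding eq by (intro nn_integral_mono mult_right_mono ennreal_leI std_normal_density_le_half) auto
  also have "\<dots> = ennreal (1/2) * emeasure lborel {-r..r}"
    by (rule nn_integral_cmult_indicator) simp
  also have "\<dots> = ennreal r"
    using assms by (subst emeasure_lborel_Icc) (auto simp: ennreal_mult'[symmetric] simp del: ennreal_half)
  finally show ?thesis .
qed

text \<open>Inserting the factor \<open>u / s \<ge> 1\<close> makes the integrand an exact
  derivative. The prefactor \<open>1 / 4\<close> comes from \<open>sqrt (2 * pi) \<ge> 5 / 2\<close>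
  and \<open>s \<ge> 8 / 5\<close>.\<close>

lemma std_normal_upper_tail:
  assumes s: "8 / 5 \<le> s"
  shows "(\<integral>\<^sup>+u. ennreal (std_normal_density u) * indicator {s..} u \<partial>lborel) \<le> ennreal (exp (- s\<^sup>2 / 2) / 4)"
proof -
  have pos: "0 < s" using s by simp
  have "(\<integral>\<^sup>+u. ennreal (std_normal_density u) * indicator {s..} u \<partial>lborel) \<le>
      (\<integral>\<^sup>+u. ennreal (u / s * std_normal_density u) * indicator {s..} u \<partial>lborel)"
  proof (intro nn_integral_mono)
    fix u
    show "ennreal (std_normal_density u) * indicator {s..} u \<le>
        ennreal (u / s * std_normal_density u) * indicator {s..} u"
    proof (cases "s \<le> u")
      case True
      then have "1 * std_normal_density u \<le> u / s * std_normal_density u"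
        using pos by (intro mult_right_mono) auto
      then show ?thesis using True by (simp add: ennreal_leI)
    qed simp
  qed
  also have "\<dots> = ennreal (0 - (- std_normal_density s / s))"
  proof (rule nn_integral_FTC_atLeast[where F = "\<lambda>u. - std_normal_density u / s"])
    fix x assume "s \<le> x"
    show "((\<lambda>u. - std_normal_density u / s) has_real_derivative x / s * std_normal_density x) (at x)"
      unfolding std_normal_density_def
      using pos by (auto intro!: derivative_eq_intros simp: field_simps)
    show "0 \<le> x / s * std_normal_density x" using pos \<open>s \<le> x\<close> by simp
  next
    have "filterlim (\<lambda>u::real. u\<^sup>2 * (1/2)) at_top at_top"
      using filterlim_at_top_mult_tendsto_pos[OF tendsto_const _ filterlim_pow_at_top[OF _ filterlim_ident],
          of "1/2" 2] by simp
    then have "((\<lambda>u::real. exp (- (u\<^sup>2 * (1/2)))) \<longlongrightarrow> 0) at_top"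
      using filterlim_compose[OF exp_at_bot] by (auto simp: filterlim_uminus_at_top)
    then have "((\<lambda>u::real. - (1 / sqrt (2 * pi) * exp (- (u\<^sup>2 * (1/2)))) / s) \<longlongrightarrow> - (1 / sqrt (2 * pi) * 0) / s) at_top"
      using pos by (intro tendsto_intros) auto
    then show "((\<lambda>u. - std_normal_density u / s) \<longlongrightarrow> 0) at_top"
      unfolding std_normal_density_def by simp
  qed simp
  also have "\<dots> \<le> ennreal (exp (- s\<^sup>2 / 2) / 4)"
  proof (rule ennreal_leI)
    have "5 / 2 \<le> sqrt (2 * pi)"
      using pi_gt3 pi_approx by (intro real_le_rsqrt) (simp add: power2_eq_square)
    then have "5 / 2 * (8 / 5) \<le> sqrt (2 * pi) * s" using s by (intro mult_mono) auto
    then have "4 * exp (- s\<^sup>2 / 2) \<le> (sqrt (2 * pi) * s) * exp (- s\<^sup>2 / 2)"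
      by (intro mult_right_mono) auto
    then show "0 - (- std_normal_density s / s) \<le> exp (- s\<^sup>2 / 2) / 4"
      unfolding std_normal_density_def using pos by (simp add: field_simps)
  qed
  finally show ?thesis .
qed

lemma std_normal_tail:
  assumes s: "8 / 5 \<le> s"
  shows "(\<integral>\<^sup>+u. ennreal (std_normal_density u) * indicator {u. s \<le> \<bar>u\<bar>} u \<partial>lborel) \<le> ennreal (exp (- s\<^sup>2 / 2) / 2)"
proof -
  let ?I = "\<integral>\<^sup>+u. ennreal (std_normal_density u) * indicator {s..} u \<partial>lborel"
  have split: "indicator {u. s \<le> \<bar>u\<bar>} u = (indicator {s..} u + indicator {s..} (-u) :: ennreal)" for u
    using s by (auto simp: indicator_def)
  have "(\<integral>\<^sup>+u. ennreal (std_normal_density u) * indicator {u. s \<le> \<bar>u\<bar>} u \<partial>lborel) =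
      ?I + (\<integral>\<^sup>+u. ennreal (std_normal_density u) * indicator {s..} (- u) \<partial>lborel)"
    unfolding split distrib_left by (rule nn_integral_add) auto
  also have "(\<integral>\<^sup>+u. ennreal (std_normal_density u) * indicator {s..} (- u) \<partial>lborel) = ?I"
    by (subst nn_integral_real_affine[where c = "-1" and t = 0]) (auto simp: std_normal_density_def)
  also have "?I + ?I \<le> ennreal (exp (- s\<^sup>2 / 2) / 4) + ennreal (exp (- s\<^sup>2 / 2) / 4)"
    by (intro add_mono std_normal_upper_tail s)
  also have "\<dots> = ennreal (exp (- s\<^sup>2 / 2) / 2)" by (subst ennreal_plus[symmetric]) auto
  finally show ?thesis .
qed

text \<open>The weight on the tail cancels the Gaussian decay exactly, so the total is
  \<open>1 + 1 / 2\<close> whatever the threshold \<open>s\<close>.\<close>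

lemma std_normal_tail_exponential:
  assumes s: "8 / 5 \<le> s"
  shows "(\<integral>\<^sup>+u. ennreal (std_normal_density u) *
            ennreal (if s \<le> \<bar>u\<bar> then exp (s\<^sup>2 / 2) else 1) \<partial>lborel) \<le> ennreal (3 / 2)"
proof -
  have "(\<integral>\<^sup>+u. ennreal (std_normal_density u) * ennreal (if s \<le> \<bar>u\<bar> then exp (s\<^sup>2 / 2) else 1) \<partial>lborel) \<le>
    (\<integral>\<^sup>+u. ennreal (std_normal_density u) +
      ennreal (exp (s\<^sup>2 / 2)) * (ennreal (std_normal_density u) * indicator {u. s \<le> \<bar>u\<bar>} u) \<partial>lborel)"
    by (intro nn_integral_mono) (auto simp: mult.commute indicator_def)
  also have "\<dots> = 1 + ennreal (exp (s\<^sup>2 / 2)) *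
      (\<integral>\<^sup>+u. ennreal (std_normal_density u) * indicator {u. s \<le> \<bar>u\<bar>} u \<partial>lborel)"
    by (subst nn_integral_add) (auto simp: nn_integral_cmult)
  also have "\<dots> \<le> 1 + ennreal (exp (s\<^sup>2 / 2)) * ennreal (exp (- s\<^sup>2 / 2) / 2)"
    by (intro add_left_mono mult_left_mono std_normal_tail s) auto
  also have "ennreal (exp (s\<^sup>2 / 2)) * ennreal (exp (- s\<^sup>2 / 2) / 2) = ennreal (1 / 2)"
    by (simp add: ennreal_mult'[symmetric] mult_exp_exp)
  also have "1 + ennreal (1 / 2) = ennreal (3 / 2)"
    by (subst ennreal_1[symmetric], subst ennreal_plus[symmetric]) auto
  finally show ?thesis .
qed

section \<open>Nets on the sphere\<close>

lemma enorm_L2_set: "enorm n x = L2_set x {..<n}"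
  by (simp add: enorm_def L2_set_def)

lemma enorm_nonneg [simp]: "0 \<le> enorm n x"
  by (simp add: enorm_L2_set)

lemma enorm_diff_triangle:
  "enorm n (\<lambda>j. x j - z j) \<le> enorm n (\<lambda>j. x j - y j) + enorm n (\<lambda>j. y j - z j)"
  using L2_set_triangle_ineq[of "\<lambda>j. x j - y j" "\<lambda>j. y j - z j" "{..<n}"]
  by (simp add: enorm_L2_set)

lemma enorm_minus_commute: "enorm n (\<lambda>j. x j - y j) = enorm n (\<lambda>j. y j - x j)"
  by (simp add: enorm_def power2_commute)

lemma enorm_scale: "enorm n (\<lambda>j. c * x j) = \<bar>c\<bar> * enorm n x"
  by (simp add: enorm_def power_mult_distrib sum_distrib_left[symmetric] real_sqrt_mult)

lemma enorm_divide: "enorm n (\<lambda>j. x j / c) = enorm n x / \<bar>c\<bar>"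
  using enorm_scale[of n "inverse c" x] by (simp add: field_simps)

lemma enorm_eq_0_iff: "x \<in> vecs n \<Longrightarrow> enorm n x = 0 \<longleftrightarrow> x = (\<lambda>_. 0)"
  by (auto simp: enorm_L2_set L2_set_eq_0_iff vecs_def fun_eq_iff) (metis lessThan_iff not_le)

lemma mat_vec_diff:
  "mat_vec m n A (\<lambda>j. x j - y j) i = mat_vec m n A x i - mat_vec m n A y i"
  by (simp add: mat_vec_def right_diff_distrib sum_subtractf)

lemma mat_vec_divide: "mat_vec m n A (\<lambda>j. x j / c) i = mat_vec m n A x i / c"
  by (simp add: mat_vec_def sum_divide_distrib)

lemma abs_mat_vec_le:
  "\<bar>mat_vec m n A v i\<bar> \<le> enorm n (\<lambda>j. A (i, j)) * enorm n v"
proof (cases "i < m")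
  case True
  have "\<bar>\<Sum>j<n. A (i, j) * v j\<bar> \<le> (\<Sum>j<n. \<bar>A (i, j)\<bar> * \<bar>v j\<bar>)"
    by (rule order.trans[OF sum_abs]) (simp add: abs_mult)
  also have "\<dots> \<le> enorm n (\<lambda>j. A (i, j)) * enorm n v"
    unfolding enorm_L2_set by (rule L2_set_mult_ineq)
  finally show ?thesis using True by (simp add: mat_vec_def)
qed (simp add: mat_vec_def)

text \<open>The floors of \<open>y j * h\<close> take finitely many values on bounded vectors.
  Picking one point of \<open>S\<close> per occupied cell keeps the centres in \<open>S\<close>, and
  \<open>sqrt n \<le> e * h\<close> bounds the diameter of a cell by \<open>e\<close>.\<close>

lemma ex_finite_net:
  assumes S: "\<And>y. y \<in> S \<Longrightarrow> enorm n y \<le> 1" and e: "0 < e"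
  shows "\<exists>F. finite F \<and> F \<subseteq> S \<and> (\<forall>y\<in>S. \<exists>c\<in>F. enorm n (\<lambda>j. y j - c j) \<le> e)"
proof -
  obtain h0 :: nat where "sqrt n / e < h0" using reals_Archimedean2 by blast
  define h where "h = real (Suc h0)"
  have h: "0 < h" "sqrt n \<le> e * h"
    using \<open>sqrt n / e < h0\<close> e by (auto simp: h_def field_simps)
  define g where "g y = (\<lambda>j\<in>{..<n}. \<lfloor>y j * h\<rfloor>)" for y
  have "g ` S \<subseteq> PiE {..<n} (\<lambda>_. {\<lfloor>- h\<rfloor>..\<lfloor>h\<rfloor>})"
  proof
    fix k assume "k \<in> g ` S"
    then obtain y where y: "y \<in> S" "k = g y" by auto
    have "\<bar>y j\<bar> \<le> 1" if "j < n" for j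
    proof -
      have "\<bar>y j\<bar> \<le> L2_set (\<lambda>j. \<bar>y j\<bar>) {..<n}" using that by (intro member_le_L2_set) auto
      also have "\<dots> = enorm n y" by (simp add: enorm_def L2_set_def)
      finally show ?thesis using S[OF y(1)] by simp
    qed
    then have "- 1 * h \<le> y j * h \<and> y j * h \<le> 1 * h" if "j < n" for j
      using that h(1) by (intro conjI mult_right_mono) (auto simp: abs_le_iff minus_le_iff)
    then show "k \<in> PiE {..<n} (\<lambda>_. {\<lfloor>- h\<rfloor>..\<lfloor>h\<rfloor>})"
      unfolding y(2) g_def by (auto intro!: floor_mono)
  qed
  then have "finite (g ` S)"
    by (rule finite_subset) (auto intro: finite_PiE)
  then obtain F where F: "F \<subseteq> S" "finite F" "g ` S = g ` F"
    by (meson finite_subset_image order_refl)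
  have "\<exists>c\<in>F. enorm n (\<lambda>j. y j - c j) \<le> e" if "y \<in> S" for y
  proof -
    have "g y \<in> g ` F" unfolding F(3)[symmetric] using that by (rule imageI)
    then obtain c where c: "c \<in> F" "g y = g c" by (auto simp only: image_iff)
    have "\<bar>y j - c j\<bar> \<le> 1 / h" if "j < n" for j
    proof -
      have "\<lfloor>y j * h\<rfloor> = \<lfloor>c j * h\<rfloor>" using fun_cong[OF c(2), of j] that by (simp add: g_def)
      then have "\<bar>y j * h - c j * h\<bar> \<le> 1" by linarith
      then have "\<bar>y j - c j\<bar> * h \<le> 1" using h(1) by (simp add: left_diff_distrib[symmetric] abs_mult)
      then show ?thesis using h(1) by (simp add: field_simps)
    qed
    then have "L2_set (\<lambda>j. \<bar>y j - c j\<bar>) {..<n} \<le> L2_set (\<lambda>_. 1 / h) {..<n}"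
      by (intro L2_set_mono) auto
    also have "\<dots> \<le> e" using h by (simp add: L2_set_constant field_simps)
    finally show ?thesis using c(1) by (auto simp: enorm_L2_set L2_set_def)
  qed
  then show ?thesis using F by blast
qed

text \<open>\<open>LEAST\<close> is attained as soon as some finite net exists, which boundedness of
  \<open>S\<close> provides.\<close>

lemma covering_number_net:
  assumes S: "\<And>y. y \<in> S \<Longrightarrow> enorm n y \<le> 1" and e: "0 < e"
  obtains F where "finite F" "F \<subseteq> S" "card F = covering_number n S e"
    "\<And>y. y \<in> S \<Longrightarrow> \<exists>c\<in>F. enorm n (\<lambda>j. y j - c j) \<le> e"
proof -
  let ?P = "\<lambda>N. \<exists>F. finite F \<and> F \<subseteq> S \<and> card F = N \<and>
      S \<subseteq> (\<Union>c\<in>F. {y. enorm n (\<lambda>j. y j - c j) \<le> e})"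
  obtain F where "finite F" "F \<subseteq> S" "\<forall>y\<in>S. \<exists>c\<in>F. enorm n (\<lambda>j. y j - c j) \<le> e"
    using ex_finite_net[of S n e, OF S e] by metis
  then have "?P (card F)" by (intro exI[of _ F]) (simp add: subset_iff)
  then have "?P (covering_number n S e)" unfolding covering_number_def by (rule LeastI[of ?P])
  then obtain G where G: "finite G" "G \<subseteq> S" "card G = covering_number n S e"
    "S \<subseteq> (\<Union>c\<in>G. {y. enorm n (\<lambda>j. y j - c j) \<le> e})" by blast
  show ?thesis
  proof (rule that[OF G(1-3)])
    fix y assume "y \<in> S"
    then show "\<exists>c\<in>G. enorm n (\<lambda>j. y j - c j) \<le> e" using G(4) by auto
  qed
qed

section \<open>Tail bounds for a fixed vector\<close>

text \<open>The Chernoff method in product form: Markov's inequality for a product over rows,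
  factorised by independence. The three tail bounds that follow differ only in the choice of
  \<open>f\<close>.\<close>

lemma gaussian_rows_markov:
  fixes f :: "nat \<Rightarrow> real \<Rightarrow> ennreal"
  assumes f [measurable]: "\<And>i. f i \<in> borel_measurable borel" and v: "enorm n v = 1"
    and K: "\<And>i. i < m \<Longrightarrow> (\<integral>\<^sup>+u. ennreal (std_normal_density u) * f i u \<partial>lborel) \<le> ennreal (K i)"
      "\<And>i. i < m \<Longrightarrow> 0 \<le> K i"
    and a: "0 < a"
    and P: "\<And>A. A \<in> space (gaussian_matrix m n) \<Longrightarrow> P A \<Longrightarrow> ennreal a \<le> (\<Prod>i<m. f i (mat_vec m n A v i))"
  shows "measure (gaussian_matrix m n) {A \<in> space (gaussian_matrix m n). P A} \<le> (\<Prod>i<m. K i) / a"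
proof -
  let ?M = "gaussian_matrix m n"
  interpret prob_space ?M by (rule prob_space_gaussian_matrix)
  let ?u = "\<lambda>A. \<Prod>i<m. f i (mat_vec m n A v i)"
  have "emeasure ?M {A \<in> space ?M. P A} \<le> emeasure ?M {A \<in> space ?M. 1 \<le> ennreal (1 / a) * ?u A}"
  proof (rule emeasure_mono)
    show "{A \<in> space ?M. P A} \<subseteq> {A \<in> space ?M. 1 \<le> ennreal (1 / a) * ?u A}"
    proof safe
      fix A assume "A \<in> space ?M" "P A"
      then have "ennreal (1 / a) * ennreal a \<le> ennreal (1 / a) * ?u A"
        by (intro mult_left_mono P) auto
      then show "1 \<le> ennreal (1 / a) * ?u A" using a by (simp add: ennreal_mult'[symmetric])
    qed
  qed measurable
  also have "\<dots> \<le> ennreal (1 / a) * (\<integral>\<^sup>+A. ?u A * indicator (space ?M) A \<partial>?M)"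
    by (rule nn_integral_Markov_inequality) measurable
  also have "(\<integral>\<^sup>+A. ?u A * indicator (space ?M) A \<partial>?M) = (\<integral>\<^sup>+A. ?u A \<partial>?M)"
    by (intro nn_integral_cong) simp
  also have "\<dots> = (\<Prod>i<m. \<integral>\<^sup>+u. ennreal (std_normal_density u) * f i u \<partial>lborel)"
    by (rule nn_integral_prod_gaussian_rows[OF f v])
  also have "ennreal (1 / a) * \<dots> \<le> ennreal (1 / a) * (\<Prod>i<m. ennreal (K i))"
    by (intro mult_left_mono prod_mono_ennreal K) auto
  also have "(\<Prod>i<m. ennreal (K i)) = ennreal (\<Prod>i<m. K i)" by (intro prod_ennreal K) auto
  also have "ennreal (1 / a) * ennreal (\<Prod>i<m. K i) = ennreal ((\<Prod>i<m. K i) / a)"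
    using a K(2) by (subst ennreal_mult'[symmetric]) (auto simp: mult.commute)
  finally show ?thesis
    unfolding emeasure_eq_measure
    by (rule ennreal_le_iff[THEN iffD1, rotated]) (use a K(2) in \<open>auto intro!: divide_nonneg_pos prod_nonneg\<close>)
qed

text \<open>\<open>d\<close> only bounds the norm from above, so one estimate serves all links of a
  chaining level. For a vector of norm zero, which cannot be normalised, the event is empty.\<close>

lemma gaussian_chi_square_tail:
  assumes v: "enorm n v \<le> d" and d: "0 < d" and s: "0 < s" and m: "0 < m"
  shows "measure (gaussian_matrix m n) {A \<in> space (gaussian_matrix m n).
      real m * (d * s)\<^sup>2 \<le> (\<Sum>i<m. (mat_vec m n A v i)\<^sup>2)} \<le> 2 ^ m * exp (- (3 / 8 * s\<^sup>2 * real m))"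
proof (cases "enorm n v = 0")
  case True
  have "mat_vec m n A v i = 0" for A i using abs_mat_vec_le[of m n A v i] True by simp
  then have "{A \<in> space (gaussian_matrix m n).
      real m * (d * s)\<^sup>2 \<le> (\<Sum>i<m. (mat_vec m n A v i)\<^sup>2)} = {}"
    using d s m by (auto simp: not_le)
  then show ?thesis by (simp only: measure_empty) simp
next
  case False
  define w where "w = (\<lambda>j. v j / enorm n v)"
  have pos: "0 < enorm n v" using False enorm_nonneg[of n v] by linarith
  have w: "enorm n w = 1" using pos unfolding w_def by (simp add: enorm_divide)
  have "measure (gaussian_matrix m n) {A \<in> space (gaussian_matrix m n).
      real m * (d * s)\<^sup>2 \<le> (\<Sum>i<m. (mat_vec m n A v i)\<^sup>2)} \<le> (\<Prod>i<m. 2) / exp (3 / 8 * s\<^sup>2 * real m)"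
  proof (rule gaussian_rows_markov[where f = "\<lambda>_ u. ennreal (exp (3 / 8 * u\<^sup>2))", OF _ w])
    fix A assume "real m * (d * s)\<^sup>2 \<le> (\<Sum>i<m. (mat_vec m n A v i)\<^sup>2)"
    moreover have "real m * (enorm n v * s)\<^sup>2 \<le> real m * (d * s)\<^sup>2"
      using v s pos by (intro mult_left_mono power_mono mult_right_mono) auto
    ultimately have "real m * (enorm n v * s)\<^sup>2 \<le> (\<Sum>i<m. (mat_vec m n A v i)\<^sup>2)" by simp
    then have "real m * s\<^sup>2 \<le> (\<Sum>i<m. (mat_vec m n A v i)\<^sup>2) / (enorm n v)\<^sup>2"
      using pos by (simp add: field_simps)
    also have "\<dots> = (\<Sum>i<m. (mat_vec m n A w i)\<^sup>2)"
      unfolding w_def mat_vec_divide by (simp add: power_divide sum_divide_distrib)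
    finally have "exp (3 / 8 * s\<^sup>2 * real m) \<le> exp (\<Sum>i<m. 3 / 8 * (mat_vec m n A w i)\<^sup>2)"
      unfolding sum_distrib_left[symmetric] by simp
    then show "ennreal (exp (3 / 8 * s\<^sup>2 * real m)) \<le> (\<Prod>i<m. ennreal (exp (3 / 8 * (mat_vec m n A w i)\<^sup>2)))"
      by (subst prod_ennreal) (auto simp: exp_sum intro: ennreal_leI)
  qed (use std_normal_exp_square in \<open>auto\<close>)
  then show ?thesis by (simp add: exp_minus field_simps)
qed

lemma gaussian_count_tail:
  assumes v: "enorm n v = 1" and s: "8 / 5 \<le> s"
  shows "measure (gaussian_matrix m n) {A \<in> space (gaussian_matrix m n).
      c \<le> (\<Sum>i<m. if s \<le> \<bar>mat_vec m n A v i\<bar> then 1 else 0)} \<le> (3 / 2) ^ m * exp (- (s\<^sup>2 / 2 * c))"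
proof -
  have "measure (gaussian_matrix m n) {A \<in> space (gaussian_matrix m n).
      c \<le> (\<Sum>i<m. if s \<le> \<bar>mat_vec m n A v i\<bar> then 1 else 0)} \<le> (\<Prod>i<m. 3 / 2) / exp (s\<^sup>2 / 2 * c)"
  proof (rule gaussian_rows_markov[where f = "\<lambda>_ u. ennreal (if s \<le> \<bar>u\<bar> then exp (s\<^sup>2 / 2) else 1)", OF _ v])
    fix A assume "c \<le> (\<Sum>i<m. if s \<le> \<bar>mat_vec m n A v i\<bar> then 1 else 0)"
    then have "s\<^sup>2 / 2 * c \<le> s\<^sup>2 / 2 * (\<Sum>i<m. if s \<le> \<bar>mat_vec m n A v i\<bar> then 1 else 0)"
      by (intro mult_left_mono) auto
    then have "exp (s\<^sup>2 / 2 * c) \<le> exp (\<Sum>i<m. s\<^sup>2 / 2 * (if s \<le> \<bar>mat_vec m n A v i\<bar> then 1 else 0))"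
      by (simp add: sum_distrib_left)
    also have "\<dots> = (\<Prod>i<m. if s \<le> \<bar>mat_vec m n A v i\<bar> then exp (s\<^sup>2 / 2) else 1)"
      unfolding exp_sum[OF finite_lessThan] by (intro prod.cong) auto
    finally show "ennreal (exp (s\<^sup>2 / 2 * c)) \<le>
        (\<Prod>i<m. ennreal (if s \<le> \<bar>mat_vec m n A v i\<bar> then exp (s\<^sup>2 / 2) else 1))"
      by (subst prod_ennreal) (auto intro: ennreal_leI)
  qed (use std_normal_tail_exponential[OF s] in auto)
  then show ?thesis by (simp add: exp_minus field_simps)
qed

text \<open>Rows outside \<open>I\<close> carry the constant function 1 and contribute the factor 1,
  leaving one small ball factor per row of \<open>I\<close>.\<close>

lemma gaussian_small_ball:
  assumes v: "0 < enorm n v" and r: "0 \<le> r" and I: "I \<subseteq> {..<m}"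
  shows "measure (gaussian_matrix m n) {A \<in> space (gaussian_matrix m n).
      \<forall>i\<in>I. \<bar>mat_vec m n A v i\<bar> \<le> r} \<le> (r / enorm n v) ^ card I"
proof -
  define w where "w = (\<lambda>j. v j / enorm n v)"
  have w: "enorm n w = 1" using v unfolding w_def by (simp add: enorm_divide)
  let ?q = "r / enorm n v"
  have "measure (gaussian_matrix m n) {A \<in> space (gaussian_matrix m n).
      \<forall>i\<in>I. \<bar>mat_vec m n A v i\<bar> \<le> r} \<le> (\<Prod>i<m. if i \<in> I then ?q else 1) / 1"
  proof (rule gaussian_rows_markov[where f = "\<lambda>i. if i \<in> I then indicator {u. \<bar>u\<bar> \<le> ?q} else (\<lambda>_. 1)", OF _ w])
    fix i
    show "(\<integral>\<^sup>+u. ennreal (std_normal_density u) * (if i \<in> I then indicator {u. \<bar>u\<bar> \<le> ?q} else (\<lambda>_. 1)) u \<partial>lborel) \<le>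
        ennreal (if i \<in> I then ?q else 1)"
      using std_normal_small_ball[of ?q] r v by auto
  next
    fix A assume "\<forall>i\<in>I. \<bar>mat_vec m n A v i\<bar> \<le> r"
    then have "\<bar>mat_vec m n A w i\<bar> \<le> ?q" if "i \<in> I" for i
      using that v unfolding w_def mat_vec_divide by (auto simp: divide_right_mono)
    then show "ennreal 1 \<le> (\<Prod>i<m. (if i \<in> I then indicator {u. \<bar>u\<bar> \<le> ?q} else (\<lambda>_. 1)) (mat_vec m n A w i))"
      by (subst prod.neutral) auto
  qed (use r v in auto)
  also have "(\<Prod>i<m. if i \<in> I then ?q else 1) = ?q ^ card I"
    using I by (subst prod.inter_restrict[symmetric]) (auto simp: Int_absorb1)
  finally show ?thesis by simp
qed

section \<open>Almost sure injectivity on many rows\<close>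

lemma measure_UNION_le_card:
  assumes "finite T" "\<And>t. t \<in> T \<Longrightarrow> B t \<in> sets M" "\<And>t. t \<in> T \<Longrightarrow> measure M (B t) \<le> b"
    and "real (card T) \<le> c" "0 \<le> b"
  shows "measure M (\<Union>t\<in>T. B t) \<le> c * b"
proof -
  have "measure M (\<Union>t\<in>T. B t) \<le> (\<Sum>t\<in>T. measure M (B t))"
    using assms by (intro measure_UNION_le) auto
  also have "\<dots> \<le> real (card T) * b" using assms by (intro sum_bounded_above) auto
  also have "\<dots> \<le> c * b" using assms by (intro mult_right_mono) auto
  finally show ?thesis .
qed

text \<open>Outer measure zero suffices: intersecting covers of measure at most
  \<open>1 / (r + 1)\<close> gives a null set without measuring \<open>E\<close> itself.\<close>

lemma (in finite_measure) null_set_coverI: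
  assumes "\<And>e. 0 < e \<Longrightarrow> \<exists>B\<in>sets M. E \<subseteq> B \<and> measure M B \<le> e"
  shows "\<exists>B\<in>null_sets M. E \<subseteq> B"
proof -
  have "\<forall>r::nat. \<exists>B\<in>sets M. E \<subseteq> B \<and> measure M B \<le> inverse (real (Suc r))"
    by (intro allI assms) simp
  then obtain B where B: "\<And>r. B r \<in> sets M" "\<And>r. E \<subseteq> B r" "\<And>r. measure M (B r) \<le> inverse (real (Suc r))"
    by metis
  have "measure M (\<Inter>r. B r) \<le> inverse (real (Suc r))" for r
    using finite_measure_mono[of "\<Inter>r. B r" "B r"] B by (meson INT_lower UNIV_I order_trans)
  then have "measure M (\<Inter>r. B r) \<le> 0"
    by (intro LIMSEQ_le_const[OF LIMSEQ_inverse_real_of_nat]) auto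
  then have "(\<Inter>r. B r) \<in> null_sets M"
    using B(1) by (auto simp: null_sets_def emeasure_eq_measure measure_le_0_iff)
  then show ?thesis using B(2) by blast
qed

text \<open>Pairs \<open>(x, w)\<close> in \<open>S\<close> and a scale \<open>q\<close> form a set of dimension \<open>2 * k + 1\<close>, while each row
  annihilating \<open>x - q * w\<close> costs one factor of the mesh size.\<close>

lemma gaussian_kernel_cover:
  fixes S :: "(nat \<Rightarrow> real) set" and k :: real
  assumes S: "\<And>y. y \<in> S \<Longrightarrow> enorm n y = 1"
    and cov: "\<And>e. 0 < e \<Longrightarrow> e < e0 \<Longrightarrow> real (covering_number n S e) \<le> e powr (- k)"
    and e0: "0 < e0" and I: "I \<subseteq> {..<m}" "2 * k + 2 \<le> real (card I)"
    and \<delta>: "0 < \<delta>" and L: "0 \<le> L" and e: "0 < e"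
  shows "\<exists>B\<in>sets (gaussian_matrix m n). {A \<in> space (gaussian_matrix m n).
      (\<forall>i<m. enorm n (\<lambda>j. A (i, j)) \<le> L) \<and>
      (\<exists>x\<in>S. \<exists>w\<in>S. \<exists>q. 0 \<le> q \<and> q \<le> 1 \<and> \<delta> \<le> enorm n (\<lambda>j. x j - q * w j) \<and>
        (\<forall>i\<in>I. mat_vec m n A (\<lambda>j. x j - q * w j) i = 0))} \<subseteq> B \<and>
      measure (gaussian_matrix m n) B \<le> e"
proof -
  let ?M = "gaussian_matrix m n"
  let ?E = "{A \<in> space ?M. (\<forall>i<m. enorm n (\<lambda>j. A (i, j)) \<le> L) \<and>
      (\<exists>x\<in>S. \<exists>w\<in>S. \<exists>q. 0 \<le> q \<and> q \<le> 1 \<and> \<delta> \<le> enorm n (\<lambda>j. x j - q * w j) \<and>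
        (\<forall>i\<in>I. mat_vec m n A (\<lambda>j. x j - q * w j) i = 0))}"
  \<comment> \<open>What remains of at most \<open>2 * N powr (2 * k + 1)\<close> net points times
    \<open>(6 * L * h / \<delta>) ^ card I\<close> once the powers of \<open>N = 1 / h\<close> are
    split off.\<close>
  define K where "K = 2 * (6 * L / \<delta>) ^ card I"
  have K: "0 \<le> K" using L \<delta> by (simp add: K_def)
  \<comment> \<open>Three demands on the mesh: below \<open>e0\<close> for the covering bound,
    \<open>6 * h < \<delta>\<close> so that an error of \<open>3 * h\<close> leaves half of
    \<open>\<delta>\<close>, and \<open>K * h \<le> e\<close> for the final probability.\<close>
  obtain N0 :: nat where N0: "max (1 / e0) (max (6 / \<delta>) (K / e)) < real N0"
    using reals_Archimedean2 by blast
  define N where "N = Suc N0"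
  have N: "1 / e0 < N" "6 / \<delta> < N" "K / e < N" "1 \<le> N" "0 < real N" using N0 by (auto simp: N_def)
  define h where "h = 1 / real N"
  have h: "0 < h" "h < e0" "6 * h < \<delta>" "K * h \<le> e"
    using N e0 \<delta> e by (auto simp: h_def field_simps)
  obtain F where F: "finite F" "F \<subseteq> S" "card F = covering_number n S h"
    "\<And>y. y \<in> S \<Longrightarrow> \<exists>c\<in>F. enorm n (\<lambda>j. y j - c j) \<le> h"
    using covering_number_net[of S n h] S h(1) by (metis order_refl)
  have cardF: "real (card F) \<le> real N powr k"
    using cov[OF h(1,2)] F(3) N by (simp add: h_def powr_minus_divide powr_divide)
  define v where "v = (\<lambda>(y, w, c) (j::nat). y j - h * real c * w j)"
  define T where "T = {p \<in> F \<times> F \<times> {..N}. \<delta> / 2 \<le> enorm n (v p)}"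
  define B where "B p = {A \<in> space ?M. \<forall>i\<in>I. \<bar>mat_vec m n A (v p) i\<bar> \<le> 3 * L * h}" for p
  have finT: "finite T" unfolding T_def using F(1) by simp
  have cardT: "real (card T) \<le> 2 * real N powr (2 * k + 1)"
  proof -
    have "card T \<le> card (F \<times> F \<times> {..N})" unfolding T_def using F(1) by (intro card_mono) auto
    then have "real (card T) \<le> real (card F) * (real (card F) * real (Suc N))"
      by (simp only: card_cartesian_product card_atMost of_nat_mult[symmetric] of_nat_le_iff)
    also have "\<dots> \<le> real N powr k * (real N powr k * (2 * real N))"
      using cardF N by (intro mult_mono) auto
    also have "\<dots> = 2 * (real N powr k * real N powr k * real N powr 1)"
      using N(5) by (simp only: powr_one mult_ac)
    also have "\<dots> = 2 * real N powr (2 * k + 1)"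
      by (simp only: powr_add[symmetric] mult_2)
    finally show ?thesis .
  qed
  have measB [measurable]: "B p \<in> sets ?M" for p
  proof -
    have "finite I" using I finite_subset by blast
    then show ?thesis unfolding B_def by measurable
  qed
  have B: "measure ?M (B p) \<le> (6 * L * h / \<delta>) ^ card I" if "p \<in> T" for p
  proof -
    have p: "\<delta> / 2 \<le> enorm n (v p)" using that by (simp add: T_def)
    have "measure ?M (B p) \<le> (3 * L * h / enorm n (v p)) ^ card I"
      unfolding B_def using p \<delta> L h I by (intro gaussian_small_ball) auto
    also have "\<dots> \<le> (3 * L * h / (\<delta> / 2)) ^ card I"
      using p \<delta> L h by (intro power_mono divide_left_mono) auto
    finally show ?thesis by (simp add: mult.assoc)
  qed
  have "measure ?M (\<Union>p\<in>T. B p) \<le> 2 * real N powr (2 * k + 1) * (6 * L * h / \<delta>) ^ card I"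
    using \<delta> L h B finT cardT by (intro measure_UNION_le_card) auto
  also have "\<dots> = K * (real N powr (2 * k + 1) * real N powr (- real (card I)))"
    using N by (simp add: K_def h_def power_divide power_mult_distrib powr_minus powr_realpow field_simps)
  also have "\<dots> = K * real N powr (2 * k + 1 - real (card I))"
    by (simp add: powr_add[symmetric])
  \<comment> \<open>Of the \<open>2 * k + 2\<close> rows, \<open>2 * k + 1\<close> pay for the net;
    the last leaves a factor \<open>1 / N\<close>, which makes the bound arbitrarily small.\<close>
  also have "\<dots> \<le> K * real N powr (-1)"
    using K N I by (intro mult_left_mono powr_mono) auto
  also have "\<dots> \<le> e" using h(4) N by (simp add: h_def powr_minus_divide)
  finally have le: "measure ?M (\<Union>p\<in>T. B p) \<le> e" .
  have "?E \<subseteq> (\<Union>p\<in>T. B p)"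
  proof safe
    fix A x w q
    assume A: "A \<in> space ?M" and L': "\<forall>i<m. enorm n (\<lambda>j. A (i, j)) \<le> L"
      and x: "x \<in> S" and w: "w \<in> S" and q: "0 \<le> q" "q \<le> 1"
      and d: "\<delta> \<le> enorm n (\<lambda>j. x j - q * w j)"
      and z: "\<forall>i\<in>I. mat_vec m n A (\<lambda>j. x j - q * w j) i = 0"
    obtain y where y: "y \<in> F" "enorm n (\<lambda>j. x j - y j) \<le> h" using F(4)[OF x] by blast
    obtain w' where w': "w' \<in> F" "enorm n (\<lambda>j. w j - w' j) \<le> h" using F(4)[OF w] by blast
    define c where "c = nat \<lfloor>q * real N\<rfloor>"
    have "real c \<le> q * real N" "q * real N \<le> real c + 1"
      unfolding c_def using q by (auto simp: of_nat_nat)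
    then have c: "\<bar>q - h * real c\<bar> \<le> h" "c \<le> N"
    proof -
      assume 1: "real c \<le> q * real N" "q * real N \<le> real c + 1"
      then have "(q - h * real c) * real N \<le> 1" "0 \<le> (q - h * real c) * real N"
        using N by (simp_all add: h_def left_diff_distrib)
      then have "q - h * real c \<le> 1 / real N" "0 \<le> q - h * real c"
        using N(5) by (simp_all add: pos_le_divide_eq zero_le_mult_iff)
      then show "\<bar>q - h * real c\<bar> \<le> h" by (simp add: h_def)
      have "q * real N \<le> 1 * real N" using q by (intro mult_right_mono) auto
      then have "real c \<le> real N" using 1 by linarith
      then show "c \<le> N" by simp
    qed
    let ?p = "(y, w', c)"
    let ?v0 = "\<lambda>j. x j - q * w j"
    have nw': "enorm n w' = 1" using w' F(2) S by blast
    \<comment> \<open>\<open>x\<close>, \<open>w\<close> and \<open>q\<close> are replaced one at a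
      time at a cost of \<open>h\<close> each, by \<open>q \<le> 1\<close> for the second and
      \<open>enorm n w' = 1\<close> for the third.\<close>
    have "enorm n (\<lambda>j. ?v0 j - v ?p j) \<le>
        enorm n (\<lambda>j. ?v0 j - (y j - q * w j)) + enorm n (\<lambda>j. (y j - q * w j) - v ?p j)"
      by (rule enorm_diff_triangle)
    also have "enorm n (\<lambda>j. (y j - q * w j) - v ?p j) \<le>
        enorm n (\<lambda>j. (y j - q * w j) - (y j - q * w' j)) + enorm n (\<lambda>j. (y j - q * w' j) - v ?p j)"
      by (rule enorm_diff_triangle)
    also have "enorm n (\<lambda>j. ?v0 j - (y j - q * w j)) \<le> h" using y by simp
    also have "enorm n (\<lambda>j. (y j - q * w j) - (y j - q * w' j)) \<le> h"
    proof -
      have "enorm n (\<lambda>j. (y j - q * w j) - (y j - q * w' j)) = enorm n (\<lambda>j. (- q) * (w j - w' j))"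
        by (simp add: algebra_simps)
      also have "\<dots> \<le> 1 * h" unfolding enorm_scale using q w' h by (intro mult_mono) auto
      finally show ?thesis by simp
    qed
    also have "enorm n (\<lambda>j. (y j - q * w' j) - v ?p j) \<le> h"
    proof -
      have "enorm n (\<lambda>j. (y j - q * w' j) - v ?p j) = enorm n (\<lambda>j. (h * real c - q) * w' j)"
        by (simp add: v_def algebra_simps)
      then show ?thesis unfolding enorm_scale using nw' c by (simp add: abs_minus_commute)
    qed
    finally have diff: "enorm n (\<lambda>j. ?v0 j - v ?p j) \<le> 3 * h" by simp
    have "enorm n ?v0 \<le> enorm n (\<lambda>j. ?v0 j - v ?p j) + enorm n (v ?p)"
      using enorm_diff_triangle[of n ?v0 "\<lambda>_. 0" "v ?p"] by simp
    then have "\<delta> / 2 \<le> enorm n (v ?p)" using d diff h by simp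
    then have "?p \<in> T" using y w' c by (simp add: T_def)
    moreover have "A \<in> B ?p"
    proof -
      have "\<bar>mat_vec m n A (v ?p) i\<bar> \<le> 3 * L * h" if "i \<in> I" for i
      proof -
        \<comment> \<open>Row \<open>i\<close> annihilates \<open>x - q * w\<close>, so on the net
          vector it sees only the discretisation error.\<close>
        have "\<bar>mat_vec m n A (v ?p) i\<bar> = \<bar>mat_vec m n A (\<lambda>j. ?v0 j - v ?p j) i\<bar>"
          using z that unfolding mat_vec_diff[of m n A ?v0 "v ?p"] by simp
        also have "\<dots> \<le> enorm n (\<lambda>j. A (i, j)) * enorm n (\<lambda>j. ?v0 j - v ?p j)"
          by (rule abs_mat_vec_le)
        also have "\<dots> \<le> L * (3 * h)" using L' L diff that I by (intro mult_mono) auto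
        finally show ?thesis by simp
      qed
      then show ?thesis using A by (simp add: B_def)
    qed
    ultimately show "A \<in> (\<Union>p\<in>T. B p)" by blast
  qed
  moreover have "(\<Union>p\<in>T. B p) \<in> sets ?M" using finT by auto
  ultimately show ?thesis using le by blast
qed

lemma sphere_proj_enorm:
  assumes "X \<subseteq> vecs n" "y \<in> sphere_proj n X"
  shows "enorm n y = 1"
  using assms enorm_eq_0_iff[of _ n] by (auto simp: sphere_proj_def enorm_divide)

lemma gaussian_rows_injective:
  fixes X :: "(nat \<Rightarrow> real) set" and k :: real
  assumes X: "X \<subseteq> vecs n"
    and cov: "\<And>e. 0 < e \<Longrightarrow> e < e0 \<Longrightarrow> real (covering_number n (sphere_proj n X) e) \<le> e powr (- k)"
    and e0: "0 < e0" and I: "I \<subseteq> {..<m}" "2 * k + 2 \<le> real (card I)"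
  shows "\<exists>B\<in>null_sets (gaussian_matrix m n). {A \<in> space (gaussian_matrix m n).
      \<exists>x\<in>X. \<exists>u\<in>X. x \<noteq> u \<and> (\<forall>i\<in>I. mat_vec m n A x i = mat_vec m n A u i)} \<subseteq> B"
proof -
  let ?M = "gaussian_matrix m n"
  let ?S = "sphere_proj n X"
  interpret prob_space ?M by (rule prob_space_gaussian_matrix)
  \<comment> \<open>A distinct pair has positive distance and a given matrix has bounded rows, so
    countably many choices of \<open>\<delta>\<close> and \<open>L\<close> exhaust the failure
    event.\<close>
  define E where "E \<delta> L = {A \<in> space ?M. (\<forall>i<m. enorm n (\<lambda>j. A (i, j)) \<le> L) \<and>
      (\<exists>x\<in>?S. \<exists>w\<in>?S. \<exists>q. 0 \<le> q \<and> q \<le> 1 \<and> \<delta> \<le> enorm n (\<lambda>j. x j - q * w j) \<and>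
        (\<forall>i\<in>I. mat_vec m n A (\<lambda>j. x j - q * w j) i = 0))}" for \<delta> L :: real
  have "\<exists>B\<in>null_sets ?M. E (inverse (real (Suc a))) (real b) \<subseteq> B" for a b
    unfolding E_def
    by (intro null_set_coverI gaussian_kernel_cover[OF sphere_proj_enorm[OF X] cov e0 I]) auto
  then obtain B where B: "\<And>a b. B a b \<in> null_sets ?M" "\<And>a b. E (inverse (real (Suc a))) (real b) \<subseteq> B a b"
    by metis
  have key: "A \<in> (\<Union>a. \<Union>b. B a b)"
    if A: "A \<in> space ?M" and x: "x \<in> X" and u: "u \<in> X" and ne: "x \<noteq> u"
      and eq: "\<forall>i\<in>I. mat_vec m n A x i = mat_vec m n A u i" and le: "enorm n u \<le> enorm n x" for A x u
  proof -
    have x0: "enorm n x \<noteq> 0"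
    proof
      assume 0: "enorm n x = 0"
      then have "enorm n u = 0" using le enorm_nonneg[of n u] by linarith
      then show False using 0 ne enorm_eq_0_iff[of x n] enorm_eq_0_iff[of u n] x u X by auto
    qed
    then have xpos: "0 < enorm n x" using enorm_nonneg[of n x] by linarith
    define y where "y = (\<lambda>j. x j / enorm n x)"
    have y: "y \<in> ?S" using x x0 enorm_eq_0_iff[of x n] X by (auto simp: sphere_proj_def y_def)
    \<comment> \<open>Dividing by the longer norm puts the ratio of lengths \<open>q\<close> into
      the unit interval. If \<open>u\<close> is zero it has no direction, and \<open>q = 0\<close>
      with the placeholder \<open>y\<close> represents it.\<close>
    have "\<exists>w\<in>?S. \<exists>q. 0 \<le> q \<and> q \<le> 1 \<and> (\<forall>j. q * w j = u j / enorm n x)"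
    proof (cases "u = (\<lambda>_. 0)")
      case True
      then show ?thesis using y by (intro bexI[OF _ y] exI[of _ 0]) auto
    next
      case False
      then have "enorm n u \<noteq> 0" using enorm_eq_0_iff[of u n] u X by auto
      moreover have "(\<lambda>j. u j / enorm n u) \<in> ?S" using u False by (auto simp: sphere_proj_def)
      ultimately show ?thesis using le xpos
        by (intro bexI[of _ "\<lambda>j. u j / enorm n u"] exI[of _ "enorm n u / enorm n x"]) auto
    qed
    then obtain w q where w: "w \<in> ?S" and q: "0 \<le> q" "q \<le> 1" and qw: "\<And>j. q * w j = u j / enorm n x"
      by blast
    have v: "(\<lambda>j. y j - q * w j) = (\<lambda>j. (x j - u j) / enorm n x)"
      by (simp add: qw y_def diff_divide_distrib)
    have "(\<lambda>j. x j - u j) \<in> vecs n" using subsetD[OF X x] subsetD[OF X u] by (auto simp: vecs_def)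
    moreover have "(\<lambda>j. x j - u j) \<noteq> (\<lambda>_. 0)" using ne by (auto simp: fun_eq_iff)
    ultimately have "enorm n (\<lambda>j. x j - u j) \<noteq> 0" using enorm_eq_0_iff by blast
    then have "0 < enorm n (\<lambda>j. x j - u j)" using enorm_nonneg[of n "\<lambda>j. x j - u j"] by linarith
    then have "0 < enorm n (\<lambda>j. y j - q * w j)"
      unfolding v enorm_divide using xpos by simp
    then obtain a where a: "inverse (real (Suc a)) < enorm n (\<lambda>j. y j - q * w j)"
      using reals_Archimedean by blast
    obtain b :: nat where b: "(\<Sum>i<m. enorm n (\<lambda>j. A (i, j))) \<le> real b"
      using real_arch_simple by blast
    have "enorm n (\<lambda>j. A (i, j)) \<le> real b" if "i < m" for i
      using b member_le_sum[of i "{..<m}" "\<lambda>i. enorm n (\<lambda>j. A (i, j))"] that by simp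
    moreover have "mat_vec m n A (\<lambda>j. y j - q * w j) i = 0" if "i \<in> I" for i
      unfolding v mat_vec_divide mat_vec_diff using eq that by simp
    ultimately have "A \<in> E (inverse (real (Suc a))) (real b)"
      unfolding E_def using A q a less_imp_le
      by (intro CollectI conjI bexI[OF _ y] bexI[OF _ w] exI[of _ q]) auto
    then show ?thesis using B(2)[of a b] by blast
  qed
  have "{A \<in> space ?M. \<exists>x\<in>X. \<exists>u\<in>X. x \<noteq> u \<and> (\<forall>i\<in>I. mat_vec m n A x i = mat_vec m n A u i)}
      \<subseteq> (\<Union>a. \<Union>b. B a b)"
  proof safe
    fix A x u
    assume *: "A \<in> space ?M" "x \<in> X" "u \<in> X" "x \<noteq> u" "\<forall>i\<in>I. mat_vec m n A x i = mat_vec m n A u i"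
    show "A \<in> (\<Union>a. \<Union>b. B a b)"
    proof (cases "enorm n u \<le> enorm n x")
      case True
      then show ?thesis by (rule key[OF *])
    next
      case False
      have "\<forall>i\<in>I. mat_vec m n A u i = mat_vec m n A x i" using *(5) by simp
      with False show ?thesis by (intro key[OF *(1) *(3) *(2) *(4)[symmetric]]) auto
    qed
  qed
  moreover have "(\<Union>a. \<Union>b. B a b) \<in> null_sets ?M" by (intro null_sets_UN B)
  ultimately show ?thesis by blast
qed

section \<open>Uniform bound on the number of saturated rows\<close>

lemma ln_numeral_bounds:
  "ln (1000::real) \<le> 7" "ln (4::real) \<le> 3 / 2" "ln (3 / 2 :: real) \<le> 21 / 50"
proof -
  have 2: "ln (2::real) \<le> 25 / 36" by (rule ln2_le_25_over_36)
  have "ln (1000::real) \<le> ln (2 ^ 10)" by (subst ln_le_cancel_iff) auto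
  also have "\<dots> = 10 * ln 2" by (simp only: ln_realpow of_nat_numeral)
  finally show "ln (1000::real) \<le> 7" using 2 by simp
  have "ln (4::real) = ln (2 ^ 2)" by simp
  also have "\<dots> = 2 * ln 2" by (simp only: ln_realpow of_nat_numeral)
  finally show "ln (4::real) \<le> 3 / 2" using 2 by simp
  have "3 / 2 \<le> exp (21 / 50 :: real)"
    using exp_lower_Taylor_quadratic[of "21 / 50 :: real"] by (simp add: power2_eq_square)
  then have "ln (3 / 2 :: real) \<le> ln (exp (21 / 50))" by (intro ln_mono) auto
  then show "ln (3 / 2 :: real) \<le> 21 / 50" by simp
qed

text \<open>Chaining: the coarsest net point \<open>x\<^sub>0\<close> at scale \<open>eps_star / 1000\<close> already decides saturation up to
  a small loss in threshold and count, since \<open>A (x - x\<^sub>0)\<close> is uniformly small in the Euclidean norm.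
  The numerical constants make the discriminant of the quadratic form
  \<open>1.858 m\<^sup>2 - 5.07 m j + 3.5 j\<^sup>2\<close> negative; here \<open>5.07 = 1 + 3.5 + 0.42 + 0.15\<close> collects the
  entropy at scale \<open>eps_star\<close>, the refinement by \<open>1 / 1000\<close>, \<open>ln (3 / 2)\<close> and the rate \<open>C\<close>.\<close>

lemma gaussian_count_uniform:
  fixes S :: "(nat \<Rightarrow> real) set" and k eps_star t :: real
  assumes S: "\<And>y. y \<in> S \<Longrightarrow> enorm n y = 1"
    and cov: "\<And>e. 0 < e \<Longrightarrow> e < eps_star \<Longrightarrow> real (covering_number n S e) \<le> e powr (- k)"
    and es: "0 < eps_star" "eps_star < 1 / 2" and k: "0 \<le> k" "k * ln (1 / eps_star) \<le> real m"
    and j: "0 < j" "2 * k \<le> real m - real j" and t: "2 * real m / real j \<le> t"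
  shows "\<exists>B\<in>sets (gaussian_matrix m n). {A \<in> space (gaussian_matrix m n).
      \<exists>x\<in>S. j \<le> card {i. i < m \<and> t \<le> \<bar>mat_vec m n A x i\<bar>}} \<subseteq> B \<and>
      measure (gaussian_matrix m n) B \<le> 3 * exp (- (3 / 20 * real m))"
proof -
  let ?M = "gaussian_matrix m n"
  interpret prob_space ?M by (rule prob_space_gaussian_matrix)
  have jm: "real j \<le> real m" using j(2) k(1) by linarith
  have m: "0 < m" "1 \<le> real m" using j(1) jm by auto
  have t2: "2 \<le> t"
  proof -
    have "2 * 1 \<le> 2 * (real m / real j)" using jm j(1) by (intro mult_left_mono) (auto simp: field_simps)
    then show ?thesis using t by simp
  qed
  \<comment> \<open>Ratio \<open>1 / 4\<close> against the growth \<open>2 ^ l\<close> allowed to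
    each link below makes the steps decay like \<open>2 ^ (- l)\<close>. The start
    \<open>eps_star / 1000\<close> keeps their sum, at most \<open>15 * E 0\<close>, below
    \<open>3 / 400\<close>, at an entropy price of only \<open>7 * k\<close>.\<close>
  define E where "E l = eps_star / 1000 / 4 ^ l" for l :: nat
  have E: "0 < E l" "E l < eps_star" "E (Suc l) = E l / 4" for l
  proof -
    show "0 < E l" using es by (simp add: E_def)
    have "eps_star * 1 < eps_star * (1000 * 4 ^ l)"
      using es by (intro mult_strict_left_mono) (auto intro: less_le_trans[of 1 1000])
    then show "E l < eps_star" using es by (simp add: E_def field_simps)
    show "E (Suc l) = E l / 4" by (simp add: E_def)
  qed
  have lnE: "k * (- ln (E l)) \<le> real m + k * (7 + 3 / 2 * real l)" for l
  proof -
    have "- ln (E l) = ln (1 / eps_star) + ln 1000 + real l * ln 4"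
      using es by (simp add: E_def ln_div ln_realpow ln_mult)
    also have "\<dots> \<le> ln (1 / eps_star) + 7 + real l * (3 / 2)"
      using ln_numeral_bounds by (intro add_mono mult_left_mono) auto
    finally have "k * (- ln (E l)) \<le> k * (ln (1 / eps_star) + 7 + real l * (3 / 2))"
      using k(1) by (intro mult_left_mono) auto
    then show ?thesis using k(2) by (simp add: algebra_simps)
  qed
  have "\<exists>F. finite F \<and> F \<subseteq> S \<and> card F = covering_number n S (E l) \<and>
      (\<forall>y\<in>S. \<exists>c\<in>F. enorm n (\<lambda>j. y j - c j) \<le> E l)" for l
    using covering_number_net[of S n "E l"] S E(1)[of l] by (metis order_refl)
  then obtain F where F: "\<And>l. finite (F l)" "\<And>l. F l \<subseteq> S" "\<And>l. card (F l) = covering_number n S (E l)"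
    "\<And>l y. y \<in> S \<Longrightarrow> \<exists>c\<in>F l. enorm n (\<lambda>j. y j - c j) \<le> E l"
    by metis
  have cardF: "real (card (F l)) \<le> exp (real m + k * (7 + 3 / 2 * real l))" for l
  proof -
    have "real (card (F l)) \<le> E l powr (- k)" unfolding F(3) using cov E by blast
    also have "\<dots> = exp (k * (- ln (E l)))" using E(1)[of l] by (simp add: powr_def)
    also have "\<dots> \<le> exp (real m + k * (7 + 3 / 2 * real l))" using lnE by simp
    finally show ?thesis .
  qed
  have k2: "k \<le> (real m - real j) / 2" "k \<le> real m / 2" using j by auto

  \<comment> \<open>Consecutive approximations of one point are at most
    \<open>E l + E (Suc l) = 5 / 4 * E l\<close> apart.\<close>
  define T where "T l = {p \<in> F l \<times> F (Suc l). enorm n (\<lambda>j. fst p j - snd p j) \<le> 5 / 4 * E l}" for l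
  define C where "C l p = {A \<in> space ?M. real m * (5 / 4 * E l * (6 * 2 ^ l))\<^sup>2 \<le>
      (\<Sum>i<m. (mat_vec m n A (\<lambda>j. fst p j - snd p j) i)\<^sup>2)}" for l p
  \<comment> \<open>The losses \<open>1 / 40\<close> in threshold and \<open>9 / 400\<close> in
    count are the allowance for passing from a point to its coarsest net point.\<close>
  define D where "D x = {A \<in> space ?M. 391 / 400 * real j \<le>
      (\<Sum>i<m. if 39 / 40 * t \<le> \<bar>mat_vec m n A x i\<bar> then 1 else 0)}" for x
  have meas: "C l p \<in> sets ?M" "D x \<in> sets ?M" for l p x
    unfolding C_def D_def by measurable

  have C: "measure ?M (\<Union>p\<in>T l. C l p) \<le> exp (- real m) * (1 / 2) ^ l" for l
  proof -
    let ?b = "2 ^ m * exp (- (3 / 8 * (6 * 2 ^ l)\<^sup>2 * real m))"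
    have fin: "finite (T l)" unfolding T_def using F(1) by simp
    have "card (T l) \<le> card (F l \<times> F (Suc l))"
      unfolding T_def using F(1) by (intro card_mono) auto
    then have "real (card (T l)) \<le> real (card (F l)) * real (card (F (Suc l)))"
      by (simp only: card_cartesian_product of_nat_mult[symmetric] of_nat_le_iff)
    also have "\<dots> \<le> exp (real m + k * (7 + 3 / 2 * real l)) * exp (real m + k * (7 + 3 / 2 * real (Suc l)))"
      by (intro mult_mono cardF) auto
    finally have card: "real (card (T l)) \<le>
      exp (real m + k * (7 + 3 / 2 * real l)) * exp (real m + k * (7 + 3 / 2 * real (Suc l)))" .
    have "measure ?M (C l p) \<le> ?b" if "p \<in> T l" for p
      unfolding C_def using that E(1)[of l] m(1)
      by (intro gaussian_chi_square_tail) (auto simp: T_def)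
    then have "measure ?M (\<Union>p\<in>T l. C l p) \<le>
        exp (real m + k * (7 + 3 / 2 * real l)) * exp (real m + k * (7 + 3 / 2 * real (Suc l))) * ?b"
      by (intro measure_UNION_le_card fin meas card) auto
    also have "?b \<le> exp (real m * 1) * exp (- (27 / 2 * (1 + 3 * real l) * real m))"
    proof (intro mult_mono)
      have "2 \<le> exp (1::real)" using exp_ge_add_one_self[of 1] by simp
      then have "2 ^ m \<le> exp (1::real) ^ m" by (intro power_mono) auto
      then show "(2::real) ^ m \<le> exp (real m * 1)" by (simp only: exp_of_nat_mult)
      have "1 + 3 * real l \<le> (1 + 3) ^ l" using Bernoulli_inequality[of 3 l] by (simp add: mult.commute)
      moreover have "(6 * 2 ^ l)\<^sup>2 = 36 * (4::real) ^ l"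
        by (simp add: power_mult_distrib power_mult[symmetric] mult.commute[of l 2] power_mult)
      ultimately have "27 / 2 * (1 + 3 * real l) * real m \<le> 3 / 8 * (6 * 2 ^ l)\<^sup>2 * real m"
        by (intro mult_right_mono) auto
      then show "exp (- (3 / 8 * (6 * 2 ^ l)\<^sup>2 * real m)) \<le> exp (- (27 / 2 * (1 + 3 * real l) * real m))"
        by simp
    qed auto
    also have "exp (real m + k * (7 + 3 / 2 * real l)) * exp (real m + k * (7 + 3 / 2 * real (Suc l))) *
        (exp (real m * 1) * exp (- (27 / 2 * (1 + 3 * real l) * real m))) =
        exp (3 * real m + k * (31 / 2 + 3 * real l) - 27 / 2 * (1 + 3 * real l) * real m)"
      by (simp add: mult_exp_exp) (simp add: field_simps)
    \<comment> \<open>With \<open>k \<le> m / 2\<close> the entropy and \<open>2 ^ m\<close> cost at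
      most \<open>43 / 4 * m + 3 / 2 * l * m\<close>, while the tail gains
      \<open>27 / 2 * m + 81 / 2 * l * m\<close>.\<close>
    also have "\<dots> \<le> exp (- real m - real l * 1)"
    proof -
      have "k * (31 / 2 + 3 * real l) \<le> real m / 2 * (31 / 2 + 3 * real l)"
        using k2 by (intro mult_right_mono) auto
      moreover have "real l * 1 \<le> real l * real m" using m by (intro mult_left_mono) auto
      ultimately show ?thesis using m by (simp add: algebra_simps)
    qed
    also have "\<dots> = exp (- real m) * exp (-1) ^ l"
      by (simp add: exp_of_nat_mult[symmetric] mult_exp_exp)
    also have "\<dots> \<le> exp (- real m) * (1 / 2) ^ l"
    proof (intro mult_left_mono power_mono)
      have "2 \<le> exp (1::real)" using exp_ge_add_one_self[of 1] by simp
      then show "exp (-1::real) \<le> 1 / 2" by (simp add: exp_minus field_simps)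
    qed auto
    finally show ?thesis by simp
  qed

  have D: "measure ?M (\<Union>x\<in>F 0. D x) \<le> exp (- (3 / 20 * real m))"
  proof -
    let ?b = "(3 / 2) ^ m * exp (- ((39 / 40 * t)\<^sup>2 / 2 * (391 / 400 * real j)))"
    have "measure ?M (D x) \<le> ?b" if "x \<in> F 0" for x
      unfolding D_def using that F(2)[of 0] S t2 by (intro gaussian_count_tail) auto
    then have "measure ?M (\<Union>x\<in>F 0. D x) \<le> exp (real m + k * (7 + 3 / 2 * real 0)) * ?b"
      by (intro measure_UNION_le_card F meas cardF) auto
    also have "(3 / 2 :: real) ^ m = exp (real m * ln (3 / 2))"
      by (simp add: exp_of_nat_mult)
    also have "exp (real m + k * (7 + 3 / 2 * real 0)) *
        (exp (real m * ln (3 / 2)) * exp (- ((39 / 40 * t)\<^sup>2 / 2 * (391 / 400 * real j)))) =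
        exp (real m + 7 * k + real m * ln (3 / 2) - (39 / 40 * t)\<^sup>2 / 2 * (391 / 400 * real j))"
      by (simp add: mult_exp_exp)
    also have "\<dots> \<le> exp (- (3 / 20 * real m))"
    proof -
      have "real m * ln (3 / 2) \<le> real m * (21 / 50)"
        using ln_numeral_bounds by (intro mult_left_mono) auto
      \<comment> \<open>\<open>929 / 500\<close> is
        \<open>4 * (39 / 40)\<^sup>2 / 2 * (391 / 400)\<close> rounded down; the 4 comes from
        squaring \<open>t \<ge> 2 * m / j\<close>.\<close>
      moreover have "929 / 500 * (real m)\<^sup>2 / real j \<le> (39 / 40 * t)\<^sup>2 / 2 * (391 / 400 * real j)"
      proof -
        let ?c = "(39 / 40 :: real)\<^sup>2 / 2 * (391 / 400)"
        have "929 / 500 * (real m)\<^sup>2 / real j \<le> 4 * ?c * ((real m)\<^sup>2 / real j)"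
          using mult_right_mono[of "929 / 500" "4 * ?c" "(real m)\<^sup>2 / real j"]
          by (simp add: power2_eq_square)
        also have "\<dots> = (2 * real m / real j)\<^sup>2 * (?c * real j)"
          using j by (simp add: power2_eq_square field_simps)
        also have "\<dots> \<le> t\<^sup>2 * (?c * real j)"
          using t by (intro mult_right_mono power_mono) auto
        also have "\<dots> = (39 / 40 * t)\<^sup>2 / 2 * (391 / 400 * real j)"
          unfolding power_mult_distrib by simp
        finally show ?thesis .
      qed
      moreover have "507 / 100 * real m - 7 / 2 * real j \<le> 929 / 500 * (real m)\<^sup>2 / real j"
      proof -
        \<comment> \<open>Completing the square in \<open>j\<close>: the worst case is
          \<open>j = 507 / 700 * m\<close>, where a positive remainder is still left.\<close>
        have "0 \<le> 7 / 2 * (real j - 507 / 700 * real m)\<^sup>2 + (929 / 500 - 7 / 2 * (507 / 700)\<^sup>2) * (real m)\<^sup>2"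
          by (intro add_nonneg_nonneg mult_nonneg_nonneg) (auto simp: power2_eq_square)
        also have "\<dots> = 929 / 500 * (real m)\<^sup>2 - (507 / 100 * real m - 7 / 2 * real j) * real j"
          by (simp add: power2_eq_square algebra_simps)
        finally show ?thesis using j by (simp add: field_simps)
      qed
      moreover have "7 * k \<le> 7 / 2 * (real m - real j)" using k2 by simp
      ultimately show ?thesis by simp
    qed
    finally show ?thesis by simp
  qed

  define B where "B = (\<Union>x\<in>F 0. D x) \<union> (\<Union>l. \<Union>p\<in>T l. C l p)"
  have finT: "finite (T l)" for l unfolding T_def using F(1) by simp
  have measC: "(\<Union>p\<in>T l. C l p) \<in> sets ?M" for l using finT meas by auto
  have measD: "(\<Union>x\<in>F 0. D x) \<in> sets ?M" using F(1) meas by auto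
  have measB: "B \<in> sets ?M" unfolding B_def using measC measD by auto
  have "measure ?M B \<le> 3 * exp (- (3 / 20 * real m))"
  proof -
    have s: "summable (\<lambda>l. exp (- real m) * (1 / 2 :: real) ^ l)"
      by (intro summable_mult summable_geometric) auto
    have sC: "summable (\<lambda>l. measure ?M (\<Union>p\<in>T l. C l p))"
      by (rule summable_comparison_test'[OF s, of 0]) (use C in auto)
    have "measure ?M (\<Union>l. \<Union>p\<in>T l. C l p) \<le> (\<Sum>l. measure ?M (\<Union>p\<in>T l. C l p))"
      using measC by (intro finite_measure_subadditive_countably sC) auto
    also have "\<dots> \<le> (\<Sum>l. exp (- real m) * (1 / 2) ^ l)"
      by (intro suminf_le C sC s)
    also have "\<dots> = exp (- real m) * 2"
      by (subst suminf_mult) (auto simp: suminf_geometric intro: summable_geometric)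
    also have "\<dots> \<le> exp (- (3 / 20 * real m)) * 2" by simp
    finally have "measure ?M (\<Union>l. \<Union>p\<in>T l. C l p) \<le> exp (- (3 / 20 * real m)) * 2" .
    moreover have "measure ?M B \<le> measure ?M (\<Union>x\<in>F 0. D x) + measure ?M (\<Union>l. \<Union>p\<in>T l. C l p)"
      unfolding B_def using measC measD by (intro measure_Un_le) auto
    ultimately show ?thesis using D by simp
  qed
  moreover have "{A \<in> space ?M. \<exists>x\<in>S. j \<le> card {i. i < m \<and> t \<le> \<bar>mat_vec m n A x i\<bar>}} \<subseteq> B"
  proof (rule subsetI, rule ccontr)
    fix A assume "A \<in> {A \<in> space ?M. \<exists>x\<in>S. j \<le> card {i. i < m \<and> t \<le> \<bar>mat_vec m n A x i\<bar>}}" and nB: "A \<notin> B"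
    then obtain x where A: "A \<in> space ?M" and x: "x \<in> S"
      and cnt: "j \<le> card {i. i < m \<and> t \<le> \<bar>mat_vec m n A x i\<bar>}" by auto
    obtain z where z: "\<And>l. z l \<in> F l" "\<And>l. enorm n (\<lambda>j. x j - z l j) \<le> E l"
      using F(4)[OF x] by metis
    let ?d = "\<lambda>v. enorm m (mat_vec m n A v)"
    have step: "?d (\<lambda>j. z l j - z (Suc l) j) \<le> sqrt m * (15 / 2 * E 0 * (1 / 2) ^ l)" for l
    proof -
      have "enorm n (\<lambda>j. z l j - z (Suc l) j) \<le> enorm n (\<lambda>j. z l j - x j) + enorm n (\<lambda>j. x j - z (Suc l) j)"
        by (rule enorm_diff_triangle)
      also have "\<dots> \<le> E l + E (Suc l)"
        using z(2)[of l] z(2)[of "Suc l"] by (simp add: enorm_minus_commute[of n "z l" x])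
      finally have "(z l, z (Suc l)) \<in> T l" using z(1) E(3)[of l] by (simp add: T_def)
      then have "A \<notin> C l (z l, z (Suc l))" using nB by (auto simp: B_def)
      then have "(\<Sum>i<m. (mat_vec m n A (\<lambda>j. z l j - z (Suc l) j) i)\<^sup>2) \<le> real m * (5 / 4 * E l * (6 * 2 ^ l))\<^sup>2"
        using A by (simp add: C_def)
      then have "?d (\<lambda>j. z l j - z (Suc l) j) \<le> sqrt (real m * (5 / 4 * E l * (6 * 2 ^ l))\<^sup>2)"
        unfolding enorm_def by simp
      also have "\<dots> = sqrt m * (5 / 4 * E l * (6 * 2 ^ l))"
        using E(1)[of l] by (simp add: real_sqrt_mult)
      also have "5 / 4 * E l * (6 * 2 ^ l) = 15 / 2 * E 0 * (1 / 2) ^ l"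
      proof -
        have "(4::real) ^ l = 2 ^ l * 2 ^ l" by (simp add: power_mult_distrib[symmetric])
        then show ?thesis by (simp add: E_def power_divide)
      qed
      finally show ?thesis .
    qed
    have tri: "?d (\<lambda>j. a j - c j) \<le> ?d (\<lambda>j. a j - b j) + ?d (\<lambda>j. b j - c j)" for a b c
      using enorm_diff_triangle[of m "mat_vec m n A a" "mat_vec m n A c" "mat_vec m n A b"]
      by (simp add: mat_vec_diff[abs_def])
    have chain: "?d (\<lambda>j. z 0 j - z l j) \<le> sqrt m * (15 * E 0 * (1 - (1 / 2) ^ l))" for l
    proof (induction l)
      case 0
      show ?case by (simp add: enorm_def mat_vec_def)
    next
      case (Suc l)
      have "?d (\<lambda>j. z 0 j - z (Suc l) j) \<le> ?d (\<lambda>j. z 0 j - z l j) + ?d (\<lambda>j. z l j - z (Suc l) j)"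
        by (rule tri)
      also have "\<dots> \<le> sqrt m * (15 * E 0 * (1 - (1 / 2) ^ l)) + sqrt m * (15 / 2 * E 0 * (1 / 2) ^ l)"
        by (intro add_mono Suc.IH step)
      also have "\<dots> = sqrt m * (15 * E 0 * (1 - (1 / 2) ^ Suc l))" by (simp add: algebra_simps)
      finally show ?case .
    qed
    \<comment> \<open>The Frobenius norm of \<open>A\<close>. No uniform bound on it is required,
      since it only multiplies \<open>E l\<close>, which tends to zero for the fixed matrix.\<close>
    define K where "K = enorm m (\<lambda>i. enorm n (\<lambda>j. A (i, j)))"
    have tail: "?d (\<lambda>j. z l j - x j) \<le> K * E l" for l
    proof -
      have "?d (\<lambda>j. z l j - x j) \<le> enorm m (\<lambda>i. E l * enorm n (\<lambda>j. A (i, j)))"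
        unfolding enorm_def
      proof (intro real_sqrt_le_mono sum_mono)
        fix i
        have "\<bar>mat_vec m n A (\<lambda>j. z l j - x j) i\<bar> \<le> enorm n (\<lambda>j. A (i, j)) * enorm n (\<lambda>j. z l j - x j)"
          by (rule abs_mat_vec_le)
        also have "\<dots> \<le> enorm n (\<lambda>j. A (i, j)) * E l"
          using z(2)[of l] by (intro mult_left_mono) (auto simp: enorm_minus_commute[of n "z l" x])
        finally have "\<bar>mat_vec m n A (\<lambda>j. z l j - x j) i\<bar> \<le> E l * enorm n (\<lambda>j. A (i, j))"
          by (simp add: mult.commute)
        then show "(mat_vec m n A (\<lambda>j. z l j - x j) i)\<^sup>2 \<le> (E l * sqrt (\<Sum>j<n. (A (i, j))\<^sup>2))\<^sup>2"
          unfolding enorm_def by (rule power2_le_iff_abs_le[THEN iffD2, rotated]) (use E(1)[of l] in \<open>auto intro!: mult_nonneg_nonneg sum_nonneg\<close>)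
      qed
      also have "\<dots> = K * E l" unfolding K_def enorm_scale using E(1)[of l] by simp
      finally show ?thesis .
    qed
    have lim: "?d (\<lambda>j. z 0 j - x j) \<le> sqrt m * (15 * E 0)"
    proof (rule LIMSEQ_le_const)
      have "(\<lambda>l. (1 / 4 :: real) ^ l) \<longlonglongrightarrow> 0" by (intro LIMSEQ_power_zero) simp
      then have "(\<lambda>l. sqrt m * (15 * E 0) + K * (eps_star / 1000 * (1 / 4) ^ l)) \<longlonglongrightarrow>
          sqrt m * (15 * E 0) + K * (eps_star / 1000 * 0)"
        by (intro tendsto_intros) auto
      then show "(\<lambda>l. sqrt m * (15 * E 0) + K * E l) \<longlonglongrightarrow> sqrt m * (15 * E 0)"
        by (simp add: E_def power_divide)
      have "?d (\<lambda>j. z 0 j - x j) \<le> sqrt m * (15 * E 0) + K * E l" for l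
      proof -
        have "sqrt m * (15 * E 0 * (1 - (1 / 2) ^ l)) \<le> sqrt m * (15 * E 0)"
          using E(1)[of 0] by (intro mult_left_mono mult_right_le_one_le) (auto simp: power_le_one)
        then show ?thesis using tri[of "z 0" x "z l"] chain[of l] tail[of l] by linarith
      qed
      then show "\<exists>N. \<forall>l\<ge>N. ?d (\<lambda>j. z 0 j - x j) \<le> sqrt m * (15 * E 0) + K * E l" by blast
    qed
    define w where "w i = mat_vec m n A (\<lambda>j. z 0 j - x j) i" for i
    have sum: "(\<Sum>i<m. (w i)\<^sup>2) \<le> real m * (3 / 400)\<^sup>2"
    proof -
      \<comment> \<open>\<open>15 * E 0 = 15 * eps_star / 1000\<close> and
        \<open>eps_star < 1 / 2\<close>.\<close>
      have "enorm m w \<le> sqrt m * (3 / 400)"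
      proof -
        have "enorm m w \<le> sqrt m * (15 * E 0)" using lim by (simp add: w_def[abs_def])
        also have "\<dots> \<le> sqrt m * (3 / 400)" using es by (intro mult_left_mono) (auto simp: E_def)
        finally show ?thesis .
      qed
      then have "(enorm m w)\<^sup>2 \<le> (sqrt m * (3 / 400))\<^sup>2" by (intro power_mono) auto
      also have "(sqrt m * (3 / 400))\<^sup>2 = real m * (3 / 400)\<^sup>2"
        by (subst power_mult_distrib) simp
      finally show ?thesis by (simp add: enorm_def sum_nonneg)
    qed
    define P where "P = {i. i < m \<and> t / 40 \<le> \<bar>w i\<bar>}"
    define Q where "Q = {i. i < m \<and> 39 / 40 * t \<le> \<bar>mat_vec m n A (z 0) i\<bar>}"
    have fin: "finite P" "finite Q" unfolding P_def Q_def by auto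
    \<comment> \<open>A Chebyshev count: few rows can move by \<open>t / 40\<close> when the total
      squared movement is small. Multiplying \<open>t \<ge> 2 * m / j\<close> by
      \<open>t \<ge> 2\<close> turns the bound by \<open>m\<close> into one by
      \<open>j\<close>.\<close>
    have cardP: "real (card P) \<le> 9 / 400 * real j"
    proof -
      have "real (card P) * (t / 40)\<^sup>2 = (\<Sum>i\<in>P. (t / 40)\<^sup>2)" by simp
      also have "\<dots> \<le> (\<Sum>i\<in>P. (w i)\<^sup>2)"
      proof (intro sum_mono)
        fix i assume "i \<in> P"
        then have "(t / 40)\<^sup>2 \<le> \<bar>w i\<bar>\<^sup>2" using t2 by (intro power_mono) (auto simp: P_def)
        then show "(t / 40)\<^sup>2 \<le> (w i)\<^sup>2" by simp
      qed
      also have "\<dots> \<le> (\<Sum>i<m. (w i)\<^sup>2)" by (intro sum_mono2) (auto simp: P_def)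
      also have "\<dots> \<le> real m * (3 / 400)\<^sup>2" by (rule sum)
      finally have 1: "real (card P) * t\<^sup>2 \<le> 9 / 100 * real m" by (simp add: power_divide)
      have "(2 * real m / real j) * 2 \<le> t * t" using t t2 by (intro mult_mono) auto
      then have "4 * real m \<le> t\<^sup>2 * real j" using j by (simp add: field_simps power2_eq_square)
      then have "9 / 100 * real m \<le> 9 / 400 * real j * t\<^sup>2" by (simp add: mult.commute)
      with 1 have "real (card P) * t\<^sup>2 \<le> 9 / 400 * real j * t\<^sup>2" by linarith
      then show ?thesis using t2 by (simp add: mult_le_cancel_right)
    qed
    have "{i. i < m \<and> t \<le> \<bar>mat_vec m n A x i\<bar>} \<subseteq> P \<union> Q"
    proof
      fix i assume i: "i \<in> {i. i < m \<and> t \<le> \<bar>mat_vec m n A x i\<bar>}"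
      then have "t / 40 \<le> \<bar>w i\<bar> \<or> 39 / 40 * t \<le> \<bar>mat_vec m n A (z 0) i\<bar>"
        unfolding w_def mat_vec_diff mem_Collect_eq by linarith
      then show "i \<in> P \<union> Q" using i by (auto simp: P_def Q_def)
    qed
    then have "j \<le> card (P \<union> Q)"
      by (rule order.trans[OF cnt card_mono[OF finite_UnI[OF fin]]])
    also have "\<dots> \<le> card P + card Q" by (rule card_Un_le)
    finally have "real j \<le> real (card P) + real (card Q)" by simp
    with cardP have "391 / 400 * real j \<le> real (card Q)" by simp
    also have "real (card Q) = (\<Sum>i\<in>Q. 1)" by simp
    also have "\<dots> = (\<Sum>i<m. if 39 / 40 * t \<le> \<bar>mat_vec m n A (z 0) i\<bar> then 1 else 0)"
      unfolding Q_def by (intro sum.mono_neutral_cong_left) auto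
    finally have "A \<in> D (z 0)" using A by (simp add: D_def)
    then have "A \<in> B" using z(1)[of 0] by (auto simp: B_def)
    then show False using nB by contradiction
  qed
  ultimately show ?thesis using measB by blast
qed

section \<open>Clipped images\<close>

text \<open>Only one argument has to be unclipped: a clipped value strictly inside the range
  determines its preimage. Hence the saturation pattern of one vector of the pair is enough.\<close>

lemma clip_eq_interior: "clip \<mu> a = clip \<mu> b \<Longrightarrow> \<bar>a\<bar> < \<mu> \<Longrightarrow> a = b"
  by (auto simp: clip_def abs_less_iff split: if_splits)

lemma sphere_proj_nonempty:
  assumes "x \<in> X" "u \<in> X" "x \<noteq> u"
  shows "sphere_proj n X \<noteq> {}"
  using assms by (auto simp: sphere_proj_def)

text \<open>A nonempty set needs at least one ball, so the quotient in the limsup is nonnegative for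
  radii below 1. This is where the positivity of \<open>k\<close> comes from.\<close>

lemma upper_box_dim_less_imp_pos:
  assumes S: "\<And>y. y \<in> S \<Longrightarrow> enorm n y \<le> 1" and ne: "S \<noteq> {}"
    and dim: "upper_box_dim n S < ereal k"
  shows "0 < k"
proof -
  have "0 \<le> upper_box_dim n S"
    unfolding upper_box_dim_def
  proof (rule order.trans[OF _ Liminf_le_Limsup])
    show "0 \<le> Liminf (at_right 0) (\<lambda>e. ereal (ln (real (covering_number n S e)) / (- ln e)))"
    proof (rule Liminf_bounded)
      have "\<forall>\<^sub>F e::real in at_right 0. 0 < e \<and> e < 1"
        by (auto simp: eventually_at_right[of 0 1] intro!: exI[of _ 1])
      then show "\<forall>\<^sub>F e in at_right 0. 0 \<le> ereal (ln (real (covering_number n S e)) / (- ln e))"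
      proof eventually_elim
        case (elim e)
        obtain F where F: "finite F" "card F = covering_number n S e"
          "\<And>y. y \<in> S \<Longrightarrow> \<exists>c\<in>F. enorm n (\<lambda>j. y j - c j) \<le> e"
          using covering_number_net[of S n e] S elim by metis
        have "F \<noteq> {}" using F(3) ne by fastforce
        then have "1 \<le> covering_number n S e"
          using F by (metis One_nat_def Suc_leI card_gt_0_iff)
        then have "0 \<le> ln (real (covering_number n S e))" by (intro ln_ge_zero) simp
        moreover have "0 < - ln e" using elim by simp
        ultimately show ?case by (simp only: divide_nonneg_pos ereal_less_eq zero_ereal_def)
      qed
    qed
  qed simp
  then have "0 < ereal k" using dim by (rule le_less_trans)
  then show ?thesis by simp
qed

theorem theorem1:
  shows "\<exists>C::real. C > 0 \<and>
    (\<forall>(m::nat) (n::nat) (\<mu>::real) (k::real) (eps_star::real) (X::(nat \<Rightarrow> real) set) (R::real).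
      \<mu> > 0 \<and> X \<subseteq> vecs n \<and> is_cone X \<and>
      upper_box_dim n (sphere_proj n X) < ereal k \<and>
      0 < eps_star \<and> eps_star < 1/2 \<and>
      (\<forall>eps. 0 < eps \<and> eps < eps_star \<longrightarrow>
         real (covering_number n (sphere_proj n X) eps) \<le> eps powr (- k)) \<and>
      real m \<ge> k * ln (1 / eps_star) \<and>
      0 < R \<and> R < \<mu> * (1/2 - (k + 1) / real m)
      \<longrightarrow>
      (\<exists>B \<in> sets (gaussian_matrix m n).
         {A \<in> space (gaussian_matrix m n). \<exists>x u. x \<in> X \<and> enorm n x < R \<and>
             u \<in> X \<and> enorm n u < R \<and> x \<noteq> u \<and>
             clip_vec m \<mu> (mat_vec m n A x) = clip_vec m \<mu> (mat_vec m n A u)} \<subseteq> B \<and>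
         measure (gaussian_matrix m n) B \<le> 12 * exp (- C * real m)))"
proof (rule exI[of _ "3 / 20"], intro conjI allI impI)
  show "0 < (3 / 20 :: real)" by simp
next
  fix m n :: nat and \<mu> k eps_star R :: real and X :: "(nat \<Rightarrow> real) set"
  let ?M = "gaussian_matrix m n"
  let ?S = "sphere_proj n X"
  let ?E = "{A \<in> space ?M. \<exists>x u. x \<in> X \<and> enorm n x < R \<and>
             u \<in> X \<and> enorm n u < R \<and> x \<noteq> u \<and>
             clip_vec m \<mu> (mat_vec m n A x) = clip_vec m \<mu> (mat_vec m n A u)}"
  assume "\<mu> > 0 \<and> X \<subseteq> vecs n \<and> is_cone X \<and>
      upper_box_dim n ?S < ereal k \<and> 0 < eps_star \<and> eps_star < 1/2 \<and>
      (\<forall>eps. 0 < eps \<and> eps < eps_star \<longrightarrow> real (covering_number n ?S eps) \<le> eps powr (- k)) \<and>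
      real m \<ge> k * ln (1 / eps_star) \<and> 0 < R \<and> R < \<mu> * (1/2 - (k + 1) / real m)"
  then have \<mu>: "0 < \<mu>" and X: "X \<subseteq> vecs n" and dim: "upper_box_dim n ?S < ereal k"
    and es: "0 < eps_star" "eps_star < 1/2"
    and cov: "\<And>e. 0 < e \<Longrightarrow> e < eps_star \<Longrightarrow> real (covering_number n ?S e) \<le> e powr (- k)"
    and km: "k * ln (1 / eps_star) \<le> real m" and R: "0 < R" "R < \<mu> * (1/2 - (k + 1) / real m)"
    by auto
  interpret prob_space ?M by (rule prob_space_gaussian_matrix)
  show "\<exists>B\<in>sets ?M. ?E \<subseteq> B \<and> measure ?M B \<le> 12 * exp (- (3 / 20) * real m)"
  \<comment> \<open>Without unit vectors the cone contains no two distinct points, so the event is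
    empty; otherwise \<open>k\<close> is positive.\<close>
  proof (cases "?S = {}")
    case True
    then have "?E = {}" using sphere_proj_nonempty by blast
    then show ?thesis by (intro bexI[of _ "{}"]) auto
  next
    case False
    have k: "0 < k" using upper_box_dim_less_imp_pos[OF _ False dim] sphere_proj_enorm[OF X] by simp
    \<comment> \<open>Excludes \<open>m = 0\<close>, where \<open>(k + 1) / real m\<close> would
      take the default value 0 and the bound on \<open>R\<close> would lose its meaning.\<close>
    have "0 < k * ln (1 / eps_star)" using k es by (intro mult_pos_pos) auto
    then have m: "0 < real m" using km by linarith
    define \<tau> where "\<tau> = real m - 2 * k - 2"
    have R': "2 * R * real m < \<mu> * \<tau>" using R(2) m by (simp add: \<tau>_def field_simps)
    then have "0 < \<mu> * \<tau>" using R m by (meson less_trans mult_pos_pos zero_less_numeral)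
    then have \<tau>: "0 < \<tau>" using \<mu> by (simp add: zero_less_mult_iff)
    \<comment> \<open>Rounding up serves both sides: \<open>\<tau> \<le> j\<close> turns the bound
      on \<open>R\<close> into \<open>t \<ge> 2 * m / j\<close>, while fewer than \<open>j\<close>
      saturated rows means fewer than \<open>\<tau>\<close>, leaving more than
      \<open>m - \<tau> = 2 * k + 2\<close> rows.\<close>
    define j where "j = nat \<lceil>\<tau>\<rceil>"
    have j: "0 < j" "\<tau> \<le> real j" "real j < \<tau> + 1" using \<tau> unfolding j_def by linarith+
    define t where "t = \<mu> / R"
    have t: "2 * real m / real j \<le> t"
    proof -
      have "\<mu> * \<tau> \<le> \<mu> * real j" using j \<mu> by (intro mult_left_mono) auto
      then show ?thesis using R' R j by (simp add: t_def field_simps)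
    qed
    have "\<exists>B\<in>sets ?M. {A \<in> space ?M. \<exists>x\<in>?S. j \<le> card {i. i < m \<and> t \<le> \<bar>mat_vec m n A x i\<bar>}} \<subseteq> B \<and>
        measure ?M B \<le> 3 * exp (- (3 / 20 * real m))"
      using k j es km t by (intro gaussian_count_uniform[OF sphere_proj_enorm[OF X] cov]) (auto simp: \<tau>_def)
    then obtain B1 where B1: "B1 \<in> sets ?M"
      "{A \<in> space ?M. \<exists>x\<in>?S. j \<le> card {i. i < m \<and> t \<le> \<bar>mat_vec m n A x i\<bar>}} \<subseteq> B1"
      "measure ?M B1 \<le> 3 * exp (- (3 / 20 * real m))"
      by (elim bexE conjE)
    \<comment> \<open>The unclipped rows vary with the matrix and the vector, so injectivity is
      secured for all finitely many candidate sets at once.\<close>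
    define \<I> where "\<I> = {I. I \<subseteq> {..<m} \<and> 2 * k + 2 \<le> real (card I)}"
    have fin: "finite \<I>" unfolding \<I>_def by simp
    define G where "G I = {A \<in> space ?M.
        \<exists>x\<in>X. \<exists>u\<in>X. x \<noteq> u \<and> (\<forall>i\<in>I. mat_vec m n A x i = mat_vec m n A u i)}" for I
    have "\<exists>B\<in>null_sets ?M. G I \<subseteq> B" if "I \<in> \<I>" for I
      using that unfolding \<I>_def G_def by (intro gaussian_rows_injective[OF X cov es(1)]) auto
    then obtain N where N: "\<And>I. I \<in> \<I> \<Longrightarrow> N I \<in> null_sets ?M" "\<And>I. I \<in> \<I> \<Longrightarrow> G I \<subseteq> N I"
      by metis
    define B2 where "B2 = (\<Union>I\<in>\<I>. N I)"
    have B2: "B2 \<in> null_sets ?M"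
      unfolding B2_def using fin N(1) by (intro null_sets_UN' countable_finite) auto
    have "?E \<subseteq> B1 \<union> B2"
    proof (rule subsetI)
      fix A assume "A \<in> ?E"
      then obtain x u where A: "A \<in> space ?M" and x: "x \<in> X" "enorm n x < R" and u: "u \<in> X" "x \<noteq> u"
        and eq: "clip_vec m \<mu> (mat_vec m n A x) = clip_vec m \<mu> (mat_vec m n A u)" by blast
      define J where "J = {i. i < m \<and> \<mu> \<le> \<bar>mat_vec m n A x i\<bar>}"
      define I where "I = {..<m} - J"
      show "A \<in> B1 \<union> B2"
      proof (cases "j \<le> card J")
        case True
        have x0: "x \<noteq> (\<lambda>_. 0)"
        proof
          assume "x = (\<lambda>_. 0)"
          then have "J = {}" using \<mu> by (auto simp: J_def mat_vec_def)
          then show False using True j(1) by simp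
        qed
        then have "enorm n x \<noteq> 0" using enorm_eq_0_iff[of x n] x X by auto
        then have pos: "0 < enorm n x" using enorm_nonneg[of n x] by linarith
        let ?y = "\<lambda>j. x j / enorm n x"
        have "?y \<in> ?S" using x x0 by (auto simp: sphere_proj_def)
        moreover have "J \<subseteq> {i. i < m \<and> t \<le> \<bar>mat_vec m n A ?y i\<bar>}"
        proof
          fix i assume i: "i \<in> J"
          \<comment> \<open>Normalising \<open>x\<close> raises the saturation level from
            \<open>\<mu>\<close> to \<open>\<mu> / enorm n x\<close>, which is at least
            \<open>t\<close> because \<open>enorm n x < R\<close>.\<close>
          have "\<mu> / R \<le> \<bar>mat_vec m n A x i\<bar> / enorm n x"
            using i x(2) pos \<mu> by (intro frac_le) (auto simp: J_def)
          then show "i \<in> {i. i < m \<and> t \<le> \<bar>mat_vec m n A ?y i\<bar>}"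
            using i by (auto simp: J_def t_def mat_vec_divide)
        qed
        then have "j \<le> card {i. i < m \<and> t \<le> \<bar>mat_vec m n A ?y i\<bar>}"
          by (rule order.trans[OF True card_mono, rotated]) simp
        ultimately show ?thesis using B1(2) A by blast
      next
        case False
        have "card I = m - card J" unfolding I_def
          by (subst card_Diff_subset) (auto simp: J_def)
        then have "I \<in> \<I>" using False j by (auto simp: \<I>_def I_def \<tau>_def)
        moreover have "mat_vec m n A x i = mat_vec m n A u i" if "i \<in> I" for i
        proof (rule clip_eq_interior)
          show "clip \<mu> (mat_vec m n A x i) = clip \<mu> (mat_vec m n A u i)"
            using fun_cong[OF eq, of i] that by (simp add: clip_vec_def I_def)
          show "\<bar>mat_vec m n A x i\<bar> < \<mu>" using that by (auto simp: I_def J_def)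
        qed
        moreover from this have "A \<in> G I" unfolding G_def using A x(1) u by blast
        ultimately show ?thesis using N(2)[of I] unfolding B2_def by blast
      qed
    qed
    moreover have "measure ?M (B1 \<union> B2) \<le> 12 * exp (- (3 / 20) * real m)"
    proof -
      have "measure ?M (B1 \<union> B2) \<le> measure ?M B1 + measure ?M B2"
        using B1 B2 by (intro measure_Un_le) auto
      also have "measure ?M B2 = 0" using B2 by (simp add: measure_eq_0_null_sets)
      also have "measure ?M B1 + 0 \<le> 12 * exp (- (3 / 20 * real m))"
        using B1(3) exp_gt_zero[of "- (3 / 20 * real m)"] by linarith
      finally show ?thesis by simp
    qed
    moreover have "B1 \<union> B2 \<in> sets ?M" using B1 B2 by auto
    ultimately show ?thesis by blast
  qed
qed

end
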